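(* Let $N\to M$ be a depth two (D2) extension of rings, with right D2 quasibasis $c_i\in (M\otimes_NM)^N$, $\gamma_i\in\mathrm{End}({}_NM_N)$. Let $R=C_M(N)$ and $A=\mathrm{End}({}_NM_N)$ (a ring under composition). For $r\in R$, $\alpha\in A$ set $$s_A(r)=\lambda(r): m\mapsto rm,\qquad t_A(r)=\rho(r): m\mapsto mr,\qquad (r\cdot\alpha\cdot r')(m)=r\alpha(m)r',$$ $$\Delta_A(\alpha)=\sum_i\gamma_i\otimes_R c_i^1\alpha(c_i^2\,-)\in A\otimes_RA,\qquad \varepsilon_A(\alpha)=\alpha(1_M).$$ Then $\langle A,R,s_A,t_A,\Delta_A,\varepsilon_A\rangle$ is a left bialgebroid over $R$, and $M$ is a left $A$-module algebroid under the action $\alpha\triangleright m=\alpha(m)$. If moreover $M_N$ is a balanced module, then the subring of invariants $M^A=\{n\in M:\alpha\triangleright n=\varepsilon_A(\alpha)n\ \ \forall\alpha\in A\}$ is equal to (the image in $M$ of) $N$.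
   Context: Rings are unital, ring homomorphisms preserve units; a ring extension $M|N$ is a ring homomorphism $N\to M$. It is left D2 if $M\otimes_NM$ is isomorphic as an $N$-$M$-bimodule to a direct summand of $\oplus^n\,{}_NM_M$ for some $n\ge 1$; right D2 if $M\otimes_NM$ is isomorphic as an $M$-$N$-bimodule to a direct summand of $\oplus^m\,{}_MM_N$ for some $m\ge 1$; D2 if both. $C_M(N)$ is the centralizer of the image of $N$. $(M\otimes_NM)^N=\{b: nb=bn\ \forall n\in N\}$, elements written $b=b^1\otimes b^2$ (summation suppressed). $M|N$ is right D2 iff it has a right D2 quasibasis: finitely many $c_i\in(M\otimes_NM)^N$ and $\gamma_i\in\mathrm{End}({}_NM_N)$ with $\sum_i\gamma_i(m)c_i^1\otimes c_i^2=1\otimes m$ for all $m\in M$. The notation $c^1\alpha(c^2-)$ means the map $m\mapsto c^1\alpha(c^2m)$. Left bialgebroid over a ring $R$: a ring $A$ with ring homomorphisms $s:R\to A$, $t:R^{op}\to A$ with $s(r)t(r')=t(r')s(r)$; $A$ is an $R$-$R$-bimodule via $r\cdot a\cdot r'=s(r)t(r')a$; and $R$-$R$-bimodule maps $\Delta:A\to A\otimes_RA$, $\Delta(a)=a_{(1)}\otimes a_{(2)}$, and $\varepsilon:A\to R$ such that: $\Delta$ is coassociative with counit $\varepsilon$; $\Delta(a)(t(r)\otimes1)=\Delta(a)(1\otimes s(r))$ for all $a\in A$, $r\in R$; $\Delta(ab)=\Delta(a)\Delta(b)$ (meaningful by the previous condition); $\Delta(1)=1\otimes1$; $\varepsilon(1)=1_R$;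 $\varepsilon(a\,s(\varepsilon(b)))=\varepsilon(ab)=\varepsilon(a\,t(\varepsilon(b)))$. Left $A$-module algebroid: a left $A$-module $M$ (with $R$-$R$-bimodule structure $r\cdot m\cdot r'=s(r)t(r')\triangleright m$) with an associative multiplication $M\otimes_RM\to M$ satisfying $a\triangleright(mm')=(a_{(1)}\triangleright m)(a_{(2)}\triangleright m')$ and a unit $1_M$, $R\to M$, $r\mapsto r\cdot1_M=1_M\cdot r$, satisfying $a\triangleright1_M=\varepsilon(a)\cdot1_M$. A right $N$-module $V$ is balanced if, with $\mathcal E=\mathrm{End}(V_N)$ acting on $V$ from the left, the natural map sending $n\in N$ to right multiplication by $n$ is a bijection $N\to\mathrm{End}({}_{\mathcal E}V)$ (a ring anti-isomorphism). *)

theory Defs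
  imports "HOL-Algebra.Free_Abelian_Groups" "HOL-Algebra.RingHom"
begin

section \<open>Bimodules\<close>

text \<open>Rings are not assumed commutative, so the library's locale \<open>module\<close> does not apply.  As there,
  a module is carried by a \<open>ring\<close> record of which only the additive part matters.\<close>

record ('s, 't, 'x) bimodule = "'x ring" +
  lact :: "'s \<Rightarrow> 'x \<Rightarrow> 'x"
  ract :: "'x \<Rightarrow> 't \<Rightarrow> 'x"

definition bimod_of ::
  "('x, 'k) ring_scheme \<Rightarrow> ('s \<Rightarrow> 'x \<Rightarrow> 'x) \<Rightarrow> ('x \<Rightarrow> 't \<Rightarrow> 'x) \<Rightarrow> ('s, 't, 'x) bimodule" where
  "bimod_of X l r =
    \<lparr>carrier = carrier X, mult = mult X, one = one X, zero = zero X, add = add X,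
     lact = l, ract = r\<rparr>"

definition regular_bimod :: "('m, 'k) ring_scheme \<Rightarrow> ('m, 'm, 'm) bimodule" where
  "regular_bimod M = bimod_of M (mult M) (mult M)"

definition restrict_scalars ::
  "('s2 \<Rightarrow> 's) \<Rightarrow> ('t2 \<Rightarrow> 't) \<Rightarrow> ('s, 't, 'x) bimodule \<Rightarrow> ('s2, 't2, 'x) bimodule" where
  "restrict_scalars f g X = bimod_of X (\<lambda>s. lact X (f s)) (\<lambda>x t. ract X x (g t))"

definition bimod_hom ::
  "('s, 'k1) ring_scheme \<Rightarrow> ('t, 'k2) ring_scheme \<Rightarrow> ('s, 't, 'x) bimodule \<Rightarrow>
   ('s, 't, 'y) bimodule \<Rightarrow> ('x \<Rightarrow> 'y) set" where
  "bimod_hom S T X Y =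
    {f \<in> carrier X \<rightarrow> carrier Y.
      (\<forall>x\<in>carrier X. \<forall>x'\<in>carrier X. f (x \<oplus>\<^bsub>X\<^esub> x') = f x \<oplus>\<^bsub>Y\<^esub> f x') \<and>
      (\<forall>s\<in>carrier S. \<forall>x\<in>carrier X. f (lact X s x) = lact Y s (f x)) \<and>
      (\<forall>t\<in>carrier T. \<forall>x\<in>carrier X. f (ract X x t) = ract Y (f x) t)}"

definition subbimodule ::
  "('s, 'k1) ring_scheme \<Rightarrow> ('t, 'k2) ring_scheme \<Rightarrow> ('s, 't, 'y) bimodule \<Rightarrow> 'y set \<Rightarrow> bool" where
  "subbimodule S T Y P \<longleftrightarrow>
    subgroup P (add_monoid Y) \<and>
    (\<forall>s\<in>carrier S. \<forall>x\<in>P. lact Y s x \<in> P) \<and>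
    (\<forall>t\<in>carrier T. \<forall>x\<in>P. ract Y x t \<in> P)"

definition iso_to_direct_summand ::
  "('s, 'k1) ring_scheme \<Rightarrow> ('t, 'k2) ring_scheme \<Rightarrow> ('s, 't, 'x) bimodule \<Rightarrow>
   ('s, 't, 'y) bimodule \<Rightarrow> bool" where
  "iso_to_direct_summand S T X Y \<longleftrightarrow>
    (\<exists>P Q. subbimodule S T Y P \<and> subbimodule S T Y Q \<and>
           P \<inter> Q = {\<zero>\<^bsub>Y\<^esub>} \<and> P <+>\<^bsub>Y\<^esub> Q = carrier Y \<and>
           (\<exists>f \<in> bimod_hom S T X (Y\<lparr>carrier := P\<rparr>). bij_betw f (carrier X) P))"

definition bimod_power :: "nat \<Rightarrow> ('s, 't, 'x) bimodule \<Rightarrow> ('s, 't, nat \<Rightarrow> 'x) bimodule" where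
  "bimod_power n X =
    \<lparr>carrier = {..<n} \<rightarrow>\<^sub>E carrier X, mult = undefined, one = undefined,
     zero = (\<lambda>i\<in>{..<n}. \<zero>\<^bsub>X\<^esub>), add = (\<lambda>v w. \<lambda>i\<in>{..<n}. v i \<oplus>\<^bsub>X\<^esub> w i),
     lact = (\<lambda>s v. \<lambda>i\<in>{..<n}. lact X s (v i)), ract = (\<lambda>v t. \<lambda>i\<in>{..<n}. ract X (v i) t)\<rparr>"

text \<open>Endomorphisms are taken extensional, so that equality in the ring is equality of functions
  on the carrier.\<close>

definition map_ring :: "('x, 'k) ring_scheme \<Rightarrow> ('x \<Rightarrow> 'x) set \<Rightarrow> ('x \<Rightarrow> 'x) ring" where
  "map_ring X F =
    \<lparr>carrier = F, mult = compose (carrier X), one = (\<lambda>x\<in>carrier X. x),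
     zero = (\<lambda>x\<in>carrier X. \<zero>\<^bsub>X\<^esub>), add = (\<lambda>f g. \<lambda>x\<in>carrier X. f x \<oplus>\<^bsub>X\<^esub> g x)\<rparr>"

definition bimod_End ::
  "('s, 'k1) ring_scheme \<Rightarrow> ('t, 'k2) ring_scheme \<Rightarrow> ('s, 't, 'x) bimodule \<Rightarrow> ('x \<Rightarrow> 'x) ring" where
  "bimod_End S T X = map_ring X (bimod_hom S T X X \<inter> extensional (carrier X))"


section \<open>Tensor products over a noncommutative ring\<close>

definition tensor_relators ::
  "('t, 'k) ring_scheme \<Rightarrow> ('s, 't, 'x) bimodule \<Rightarrow> ('t, 'u, 'y) bimodule \<Rightarrow> ('x \<times> 'y \<Rightarrow>\<^sub>0 int) set" where
  "tensor_relators T X Y =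
    {frag_of (x \<oplus>\<^bsub>X\<^esub> x', y) - frag_of (x, y) - frag_of (x', y) | x x' y.
       x \<in> carrier X \<and> x' \<in> carrier X \<and> y \<in> carrier Y} \<union>
    {frag_of (x, y \<oplus>\<^bsub>Y\<^esub> y') - frag_of (x, y) - frag_of (x, y') | x y y'.
       x \<in> carrier X \<and> y \<in> carrier Y \<and> y' \<in> carrier Y} \<union>
    {frag_of (ract X x t, y) - frag_of (x, lact Y t y) | x t y.
       x \<in> carrier X \<and> t \<in> carrier T \<and> y \<in> carrier Y}"

abbreviation tensor_free ::
  "('s, 't, 'x) bimodule \<Rightarrow> ('t, 'u, 'y) bimodule \<Rightarrow> ('x \<times> 'y \<Rightarrow>\<^sub>0 int) monoid" where
  "tensor_free X Y \<equiv> free_Abelian_group (carrier X \<times> carrier Y)"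

definition tensor_kernel ::
  "('t, 'k) ring_scheme \<Rightarrow> ('s, 't, 'x) bimodule \<Rightarrow> ('t, 'u, 'y) bimodule \<Rightarrow> ('x \<times> 'y \<Rightarrow>\<^sub>0 int) set" where
  "tensor_kernel T X Y = generate (tensor_free X Y) (tensor_relators T X Y)"

definition tensor_group ::
  "('t, 'k) ring_scheme \<Rightarrow> ('s, 't, 'x) bimodule \<Rightarrow> ('t, 'u, 'y) bimodule \<Rightarrow>
   ('x \<times> 'y \<Rightarrow>\<^sub>0 int) set ring" where
  "tensor_group T X Y = (let Q = tensor_free X Y Mod tensor_kernel T X Y in
    \<lparr>carrier = carrier Q, mult = undefined, one = undefined, zero = \<one>\<^bsub>Q\<^esub>, add = mult Q\<rparr>)"

definition pure_tensor ::
  "('t, 'k) ring_scheme \<Rightarrow> ('s, 't, 'x) bimodule \<Rightarrow> ('t, 'u, 'y) bimodule \<Rightarrow> 'x \<Rightarrow> 'y \<Rightarrow>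
   ('x \<times> 'y \<Rightarrow>\<^sub>0 int) set" where
  "pure_tensor T X Y x y = tensor_kernel T X Y #>\<^bsub>tensor_free X Y\<^esub> frag_of (x, y)"

text \<open>The additive map out of a tensor product determined by \<open>x \<otimes> y \<mapsto> b x y\<close>; meaningful only if
  \<open>b\<close> is biadditive and balanced.  On the class of \<open>\<Sum>\<^sub>j k\<^sub>j (x\<^sub>j, y\<^sub>j)\<close> it is \<open>\<Sum>\<^sub>j k\<^sub>j b x\<^sub>j y\<^sub>j\<close>.\<close>

definition tensor_lift ::
  "('g, 'k) ring_scheme \<Rightarrow> ('x \<Rightarrow> 'y \<Rightarrow> 'g) \<Rightarrow> ('x \<times> 'y \<Rightarrow>\<^sub>0 int) set \<Rightarrow> 'g" where
  "tensor_lift G b q =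
    the_elem ((\<lambda>p. \<Oplus>\<^bsub>G\<^esub>z\<in>Poly_Mapping.keys p. [Poly_Mapping.lookup p z] \<cdot>\<^bsub>G\<^esub> b (fst z) (snd z)) ` q)"

definition tensor ::
  "('t, 'k) ring_scheme \<Rightarrow> ('s, 't, 'x) bimodule \<Rightarrow> ('t, 'u, 'y) bimodule \<Rightarrow>
   ('s, 'u, ('x \<times> 'y \<Rightarrow>\<^sub>0 int) set) bimodule" where
  "tensor T X Y = (let G = tensor_group T X Y in bimod_of G
     (\<lambda>s. tensor_lift G (\<lambda>x y. pure_tensor T X Y (lact X s x) y))
     (\<lambda>q u. tensor_lift G (\<lambda>x y. pure_tensor T X Y x (ract Y y u)) q))"

definition tensor_assoc ::
  "('t, 'k1) ring_scheme \<Rightarrow> ('u, 'k2) ring_scheme \<Rightarrow> ('s, 't, 'x) bimodule \<Rightarrow> ('t, 'u, 'y) bimodule \<Rightarrow>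
   ('u, 'v, 'z) bimodule \<Rightarrow> (('x \<times> 'y \<Rightarrow>\<^sub>0 int) set \<times> 'z \<Rightarrow>\<^sub>0 int) set \<Rightarrow>
   ('x \<times> ('y \<times> 'z \<Rightarrow>\<^sub>0 int) set \<Rightarrow>\<^sub>0 int) set" where
  "tensor_assoc T U X Y Z = (let YZ = tensor U Y Z; G = tensor T X YZ in
     tensor_lift G (\<lambda>q z. tensor_lift G (\<lambda>x y. pure_tensor T X YZ x (pure_tensor U Y Z y z)) q))"


section \<open>Depth two extensions\<close>

definition extension_tensor ::
  "('n, 'k1) ring_scheme \<Rightarrow> ('m, 'k2) ring_scheme \<Rightarrow> ('n \<Rightarrow> 'm) \<Rightarrow>
   ('m, 'm, ('m \<times> 'm \<Rightarrow>\<^sub>0 int) set) bimodule" where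
  "extension_tensor N M h =
     tensor N (restrict_scalars id h (regular_bimod M)) (restrict_scalars h id (regular_bimod M))"

definition left_D2 ::
  "('n, 'k1) ring_scheme \<Rightarrow> ('m, 'k2) ring_scheme \<Rightarrow> ('n \<Rightarrow> 'm) \<Rightarrow> bool" where
  "left_D2 N M h \<longleftrightarrow> (\<exists>n\<ge>1. iso_to_direct_summand N M
     (restrict_scalars h id (extension_tensor N M h))
     (bimod_power n (restrict_scalars h id (regular_bimod M))))"

definition right_D2 ::
  "('n, 'k1) ring_scheme \<Rightarrow> ('m, 'k2) ring_scheme \<Rightarrow> ('n \<Rightarrow> 'm) \<Rightarrow> bool" where
  "right_D2 N M h \<longleftrightarrow> (\<exists>m\<ge>1. iso_to_direct_summand M N
     (restrict_scalars id h (extension_tensor N M h))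
     (bimod_power m (restrict_scalars id h (regular_bimod M))))"

definition D2 ::
  "('n, 'k1) ring_scheme \<Rightarrow> ('m, 'k2) ring_scheme \<Rightarrow> ('n \<Rightarrow> 'm) \<Rightarrow> bool" where
  "D2 N M h \<longleftrightarrow> left_D2 N M h \<and> right_D2 N M h"

definition centralizer_ring ::
  "('n, 'k1) ring_scheme \<Rightarrow> ('m, 'k2) ring_scheme \<Rightarrow> ('n \<Rightarrow> 'm) \<Rightarrow> ('m, 'k2) ring_scheme" where
  "centralizer_ring N M h =
     M\<lparr>carrier := {m \<in> carrier M. \<forall>n\<in>carrier N. h n \<otimes>\<^bsub>M\<^esub> m = m \<otimes>\<^bsub>M\<^esub> h n}\<rparr>"

definition extension_End ::
  "('n, 'k1) ring_scheme \<Rightarrow> ('m, 'k2) ring_scheme \<Rightarrow> ('n \<Rightarrow> 'm) \<Rightarrow> ('m \<Rightarrow> 'm) ring" where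
  "extension_End N M h = bimod_End N N (restrict_scalars h h (regular_bimod M))"

definition tensor_centralizer ::
  "('n, 'k1) ring_scheme \<Rightarrow> ('m, 'k2) ring_scheme \<Rightarrow> ('n \<Rightarrow> 'm) \<Rightarrow> ('m \<times> 'm \<Rightarrow>\<^sub>0 int) set set" where
  "tensor_centralizer N M h =
     {b \<in> carrier (extension_tensor N M h).
       \<forall>n\<in>carrier N. lact (extension_tensor N M h) (h n) b = ract (extension_tensor N M h) b (h n)}"

definition right_D2_quasibasis ::
  "('n, 'k1) ring_scheme \<Rightarrow> ('m, 'k2) ring_scheme \<Rightarrow> ('n \<Rightarrow> 'm) \<Rightarrow> 'i set \<Rightarrow>
   ('i \<Rightarrow> ('m \<times> 'm \<Rightarrow>\<^sub>0 int) set) \<Rightarrow> ('i \<Rightarrow> 'm \<Rightarrow> 'm) \<Rightarrow> bool" where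
  "right_D2_quasibasis N M h I c \<gamma> \<longleftrightarrow>
     finite I \<and>
     c \<in> I \<rightarrow> tensor_centralizer N M h \<and>
     \<gamma> \<in> I \<rightarrow> carrier (extension_End N M h) \<and>
     (\<forall>m\<in>carrier M.
       (\<Oplus>\<^bsub>extension_tensor N M h\<^esub>i\<in>I. lact (extension_tensor N M h) (\<gamma> i m) (c i)) =
       pure_tensor N (restrict_scalars id h (regular_bimod M)) (restrict_scalars h id (regular_bimod M))
         \<one>\<^bsub>M\<^esub> m)"


section \<open>Balanced modules\<close>

text \<open>A right \<open>N\<close>-module is given by an additive group \<open>V\<close> and an action \<open>r\<close>.\<close>

definition right_module_End ::
  "('n, 'k1) ring_scheme \<Rightarrow> ('v, 'k2) ring_scheme \<Rightarrow> ('v \<Rightarrow> 'n \<Rightarrow> 'v) \<Rightarrow> ('v \<Rightarrow> 'v) ring" where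
  "right_module_End N V r = map_ring V
    {f \<in> carrier V \<rightarrow>\<^sub>E carrier V.
      (\<forall>x\<in>carrier V. \<forall>y\<in>carrier V. f (x \<oplus>\<^bsub>V\<^esub> y) = f x \<oplus>\<^bsub>V\<^esub> f y) \<and>
      (\<forall>n\<in>carrier N. \<forall>x\<in>carrier V. f (r x n) = r (f x) n)}"

definition left_module_End ::
  "('e, 'k1) ring_scheme \<Rightarrow> ('v, 'k2) ring_scheme \<Rightarrow> ('e \<Rightarrow> 'v \<Rightarrow> 'v) \<Rightarrow> ('v \<Rightarrow> 'v) ring" where
  "left_module_End E V l = map_ring V
    {f \<in> carrier V \<rightarrow>\<^sub>E carrier V.
      (\<forall>x\<in>carrier V. \<forall>y\<in>carrier V. f (x \<oplus>\<^bsub>V\<^esub> y) = f x \<oplus>\<^bsub>V\<^esub> f y) \<and>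
      (\<forall>e\<in>carrier E. \<forall>x\<in>carrier V. f (l e x) = l e (f x))}"

definition balanced ::
  "('n, 'k1) ring_scheme \<Rightarrow> ('v, 'k2) ring_scheme \<Rightarrow> ('v \<Rightarrow> 'n \<Rightarrow> 'v) \<Rightarrow> bool" where
  "balanced N V r \<longleftrightarrow>
     bij_betw (\<lambda>n. \<lambda>v\<in>carrier V. r v n) (carrier N)
       (carrier (left_module_End (right_module_End N V r) V (\<lambda>e v. e v)))"


section \<open>Left bialgebroids and their module algebroids\<close>

definition opposite_ring :: "('r, 'k) ring_scheme \<Rightarrow> ('r, 'k) ring_scheme" where
  "opposite_ring R = R\<lparr>mult := (\<lambda>x y. y \<otimes>\<^bsub>R\<^esub> x)\<rparr>"

definition bialgebroid_bimod ::
  "('a, 'k) ring_scheme \<Rightarrow> ('r \<Rightarrow> 'a) \<Rightarrow> ('r \<Rightarrow> 'a) \<Rightarrow> ('r, 'r, 'a) bimodule" where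
  "bialgebroid_bimod A s t = bimod_of A (\<lambda>r a. s r \<otimes>\<^bsub>A\<^esub> a) (\<lambda>a r. t r \<otimes>\<^bsub>A\<^esub> a)"

abbreviation bialgebroid_tensor ::
  "('r, 'k1) ring_scheme \<Rightarrow> ('a, 'k2) ring_scheme \<Rightarrow> ('r \<Rightarrow> 'a) \<Rightarrow> ('r \<Rightarrow> 'a) \<Rightarrow>
   ('r, 'r, ('a \<times> 'a \<Rightarrow>\<^sub>0 int) set) bimodule" where
  "bialgebroid_tensor R A s t \<equiv> tensor R (bialgebroid_bimod A s t) (bialgebroid_bimod A s t)"

abbreviation bialgebroid_pure ::
  "('r, 'k1) ring_scheme \<Rightarrow> ('a, 'k2) ring_scheme \<Rightarrow> ('r \<Rightarrow> 'a) \<Rightarrow> ('r \<Rightarrow> 'a) \<Rightarrow> 'a \<Rightarrow> 'a \<Rightarrow>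
   ('a \<times> 'a \<Rightarrow>\<^sub>0 int) set" where
  "bialgebroid_pure R A s t \<equiv> pure_tensor R (bialgebroid_bimod A s t) (bialgebroid_bimod A s t)"

text \<open>\<open>(a \<otimes> b, c \<otimes> d) \<mapsto> ac \<otimes> bd\<close>: well defined when the first argument \<open>p\<close> satisfies
  \<open>p (t r \<otimes> 1) = p (1 \<otimes> s r)\<close> for all \<open>r\<close>; for arbitrary \<open>p\<close> it is not.\<close>

definition takeuchi_mult ::
  "('r, 'k1) ring_scheme \<Rightarrow> ('a, 'k2) ring_scheme \<Rightarrow> ('r \<Rightarrow> 'a) \<Rightarrow> ('r \<Rightarrow> 'a) \<Rightarrow>
   ('a \<times> 'a \<Rightarrow>\<^sub>0 int) set \<Rightarrow> ('a \<times> 'a \<Rightarrow>\<^sub>0 int) set \<Rightarrow> ('a \<times> 'a \<Rightarrow>\<^sub>0 int) set" where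
  "takeuchi_mult R A s t p q =
     tensor_lift (bialgebroid_tensor R A s t)
       (\<lambda>c d. tensor_lift (bialgebroid_tensor R A s t)
          (\<lambda>a b. bialgebroid_pure R A s t (a \<otimes>\<^bsub>A\<^esub> c) (b \<otimes>\<^bsub>A\<^esub> d)) p) q"

locale left_bialgebroid = R?: ring R + A?: ring A
  for R :: "('r, 'k1) ring_scheme" and A :: "('a, 'k2) ring_scheme"
    and s t :: "'r \<Rightarrow> 'a" and \<Delta> :: "'a \<Rightarrow> ('a \<times> 'a \<Rightarrow>\<^sub>0 int) set" and \<epsilon> :: "'a \<Rightarrow> 'r" +
  assumes source_hom: "s \<in> ring_hom R A"
    and target_hom: "t \<in> ring_hom (opposite_ring R) A"
    and source_target_commute:
      "\<lbrakk>r \<in> carrier R; r' \<in> carrier R\<rbrakk> \<Longrightarrow> s r \<otimes>\<^bsub>A\<^esub> t r' = t r' \<otimes>\<^bsub>A\<^esub> s r"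
    and comult_hom: "\<Delta> \<in> bimod_hom R R (bialgebroid_bimod A s t) (bialgebroid_tensor R A s t)"
    and counit_hom: "\<epsilon> \<in> bimod_hom R R (bialgebroid_bimod A s t) (regular_bimod R)"
    and coassoc:
      "a \<in> carrier A \<Longrightarrow>
         tensor_assoc R R (bialgebroid_bimod A s t) (bialgebroid_bimod A s t) (bialgebroid_bimod A s t)
           (tensor_lift (tensor R (bialgebroid_tensor R A s t) (bialgebroid_bimod A s t))
             (\<lambda>b c. pure_tensor R (bialgebroid_tensor R A s t) (bialgebroid_bimod A s t) (\<Delta> b) c)
             (\<Delta> a)) =
         tensor_lift (tensor R (bialgebroid_bimod A s t) (bialgebroid_tensor R A s t))
           (\<lambda>b c. pure_tensor R (bialgebroid_bimod A s t) (bialgebroid_tensor R A s t) b (\<Delta> c))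
           (\<Delta> a)"
    and counit_left:
      "a \<in> carrier A \<Longrightarrow> tensor_lift A (\<lambda>b c. lact (bialgebroid_bimod A s t) (\<epsilon> b) c) (\<Delta> a) = a"
    and counit_right:
      "a \<in> carrier A \<Longrightarrow> tensor_lift A (\<lambda>b c. ract (bialgebroid_bimod A s t) b (\<epsilon> c)) (\<Delta> a) = a"
    and comult_takeuchi:
      "\<lbrakk>a \<in> carrier A; r \<in> carrier R\<rbrakk> \<Longrightarrow>
         tensor_lift (bialgebroid_tensor R A s t)
           (\<lambda>b c. bialgebroid_pure R A s t (b \<otimes>\<^bsub>A\<^esub> t r) c) (\<Delta> a) =
         tensor_lift (bialgebroid_tensor R A s t)
           (\<lambda>b c. bialgebroid_pure R A s t b (c \<otimes>\<^bsub>A\<^esub> s r)) (\<Delta> a)"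
    and comult_mult:
      "\<lbrakk>a \<in> carrier A; b \<in> carrier A\<rbrakk> \<Longrightarrow>
         \<Delta> (a \<otimes>\<^bsub>A\<^esub> b) = takeuchi_mult R A s t (\<Delta> a) (\<Delta> b)"
    and comult_one: "\<Delta> \<one>\<^bsub>A\<^esub> = bialgebroid_pure R A s t \<one>\<^bsub>A\<^esub> \<one>\<^bsub>A\<^esub>"
    and counit_one: "\<epsilon> \<one>\<^bsub>A\<^esub> = \<one>\<^bsub>R\<^esub>"
    and counit_source:
      "\<lbrakk>a \<in> carrier A; b \<in> carrier A\<rbrakk> \<Longrightarrow> \<epsilon> (a \<otimes>\<^bsub>A\<^esub> s (\<epsilon> b)) = \<epsilon> (a \<otimes>\<^bsub>A\<^esub> b)"
    and counit_target:
      "\<lbrakk>a \<in> carrier A; b \<in> carrier A\<rbrakk> \<Longrightarrow> \<epsilon> (a \<otimes>\<^bsub>A\<^esub> t (\<epsilon> b)) = \<epsilon> (a \<otimes>\<^bsub>A\<^esub> b)"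

locale left_module = A?: ring A + V?: abelian_group V
  for A :: "('a, 'k1) ring_scheme" and V :: "('v, 'k2) ring_scheme"
    and act :: "'a \<Rightarrow> 'v \<Rightarrow> 'v" +
  assumes act_closed: "\<lbrakk>a \<in> carrier A; x \<in> carrier V\<rbrakk> \<Longrightarrow> act a x \<in> carrier V"
    and act_add_left:
      "\<lbrakk>a \<in> carrier A; b \<in> carrier A; x \<in> carrier V\<rbrakk> \<Longrightarrow> act (a \<oplus>\<^bsub>A\<^esub> b) x = act a x \<oplus>\<^bsub>V\<^esub> act b x"
    and act_add_right:
      "\<lbrakk>a \<in> carrier A; x \<in> carrier V; y \<in> carrier V\<rbrakk> \<Longrightarrow> act a (x \<oplus>\<^bsub>V\<^esub> y) = act a x \<oplus>\<^bsub>V\<^esub> act a y"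
    and act_mult:
      "\<lbrakk>a \<in> carrier A; b \<in> carrier A; x \<in> carrier V\<rbrakk> \<Longrightarrow> act (a \<otimes>\<^bsub>A\<^esub> b) x = act a (act b x)"
    and act_one: "x \<in> carrier V \<Longrightarrow> act \<one>\<^bsub>A\<^esub> x = x"

definition module_bimod ::
  "('m, 'k) ring_scheme \<Rightarrow> ('r \<Rightarrow> 'a) \<Rightarrow> ('r \<Rightarrow> 'a) \<Rightarrow> ('a \<Rightarrow> 'm \<Rightarrow> 'm) \<Rightarrow> ('r, 'r, 'm) bimodule" where
  "module_bimod M s t act = bimod_of M (\<lambda>r. act (s r)) (\<lambda>m r. act (t r) m)"

text \<open>An associative unital multiplication that factors through \<open>M \<otimes>\<^sub>R M\<close> is in particular
  biadditive, so \<open>M\<close> is a ring; the factorization is \<open>mult_factors\<close>.\<close>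

locale left_module_algebroid =
  left_bialgebroid R A s t \<Delta> \<epsilon> + left_module A M act + M?: ring M
  for R :: "('r, 'k1) ring_scheme" and A :: "('a, 'k2) ring_scheme"
    and s t :: "'r \<Rightarrow> 'a" and \<Delta> :: "'a \<Rightarrow> ('a \<times> 'a \<Rightarrow>\<^sub>0 int) set" and \<epsilon> :: "'a \<Rightarrow> 'r"
    and M :: "('m, 'k3) ring_scheme" and act :: "'a \<Rightarrow> 'm \<Rightarrow> 'm" +
  assumes mult_factors:
      "\<exists>\<mu> \<in> bimod_hom R R (tensor R (module_bimod M s t act) (module_bimod M s t act))
              (module_bimod M s t act).
         \<forall>x\<in>carrier M. \<forall>y\<in>carrier M.
           \<mu> (pure_tensor R (module_bimod M s t act) (module_bimod M s t act) x y) = x \<otimes>\<^bsub>M\<^esub> y"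
    and act_product:
      "\<lbrakk>a \<in> carrier A; x \<in> carrier M; y \<in> carrier M\<rbrakk> \<Longrightarrow>
         act a (x \<otimes>\<^bsub>M\<^esub> y) = tensor_lift M (\<lambda>b c. act b x \<otimes>\<^bsub>M\<^esub> act c y) (\<Delta> a)"
    and unit_central:
      "r \<in> carrier R \<Longrightarrow>
         lact (module_bimod M s t act) r \<one>\<^bsub>M\<^esub> = ract (module_bimod M s t act) \<one>\<^bsub>M\<^esub> r"
    and act_unit:
      "a \<in> carrier A \<Longrightarrow> act a \<one>\<^bsub>M\<^esub> = lact (module_bimod M s t act) (\<epsilon> a) \<one>\<^bsub>M\<^esub>"

section \<open>The bialgebroid of a depth two extension\<close>

definition D2_source :: "('m, 'k) ring_scheme \<Rightarrow> 'm \<Rightarrow> 'm \<Rightarrow> 'm" where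
  "D2_source M r = (\<lambda>m\<in>carrier M. r \<otimes>\<^bsub>M\<^esub> m)"

definition D2_target :: "('m, 'k) ring_scheme \<Rightarrow> 'm \<Rightarrow> 'm \<Rightarrow> 'm" where
  "D2_target M r = (\<lambda>m\<in>carrier M. m \<otimes>\<^bsub>M\<^esub> r)"

definition D2_bimod ::
  "('n, 'k1) ring_scheme \<Rightarrow> ('m, 'k2) ring_scheme \<Rightarrow> ('n \<Rightarrow> 'm) \<Rightarrow> ('m, 'm, 'm \<Rightarrow> 'm) bimodule" where
  "D2_bimod N M h = bimod_of (extension_End N M h)
     (\<lambda>r \<alpha>. \<lambda>m\<in>carrier M. r \<otimes>\<^bsub>M\<^esub> \<alpha> m) (\<lambda>\<alpha> r. \<lambda>m\<in>carrier M. \<alpha> m \<otimes>\<^bsub>M\<^esub> r)"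

text \<open>The second factor is the map \<open>c\<^sub>i\<^sup>1 \<alpha> (c\<^sub>i\<^sup>2 -)\<close>.\<close>

definition D2_comult ::
  "('n, 'k1) ring_scheme \<Rightarrow> ('m, 'k2) ring_scheme \<Rightarrow> ('n \<Rightarrow> 'm) \<Rightarrow> 'i set \<Rightarrow>
   ('i \<Rightarrow> ('m \<times> 'm \<Rightarrow>\<^sub>0 int) set) \<Rightarrow> ('i \<Rightarrow> 'm \<Rightarrow> 'm) \<Rightarrow>
   ('m \<Rightarrow> 'm) \<Rightarrow> (('m \<Rightarrow> 'm) \<times> ('m \<Rightarrow> 'm) \<Rightarrow>\<^sub>0 int) set" where
  "D2_comult N M h I c \<gamma> \<alpha> =
     (\<Oplus>\<^bsub>tensor (centralizer_ring N M h) (D2_bimod N M h) (D2_bimod N M h)\<^esub>i\<in>I.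
        pure_tensor (centralizer_ring N M h) (D2_bimod N M h) (D2_bimod N M h) (\<gamma> i)
          (\<lambda>m\<in>carrier M. tensor_lift M (\<lambda>x y. x \<otimes>\<^bsub>M\<^esub> \<alpha> (y \<otimes>\<^bsub>M\<^esub> m)) (c i)))"

definition D2_counit :: "('m, 'k) ring_scheme \<Rightarrow> ('m \<Rightarrow> 'm) \<Rightarrow> 'm" where
  "D2_counit M \<alpha> = \<alpha> \<one>\<^bsub>M\<^esub>"

end

theory Submission
  imports Defs
begin

text \<open>The key fact is that \<open>A \<otimes>\<^sub>R \<dots> \<otimes>\<^sub>R A\<close> embeds into the multilinear maps \<open>M \<times> \<dots> \<times> M \<rightarrow> M\<close>
  through \<open>\<alpha> \<otimes> \<beta> \<mapsto> ((m, m') \<mapsto> \<alpha>(m) \<beta>(m'))\<close>: if \<open>Y\<close> is a left \<open>R\<close>-module of \<open>M\<close>-valued functions, the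
  quasibasis gives \<open>q = \<Sum>\<^sub>i \<gamma>\<^sub>i \<otimes> c\<^sub>i\<^sup>1 q(c\<^sub>i\<^sup>2, -)\<close> for every \<open>q \<in> A \<otimes>\<^sub>R Y\<close>, so \<open>q\<close> is determined by
  its values.  Under this embedding \<open>\<Delta>(\<alpha>)\<close> becomes \<open>(m, m') \<mapsto> \<alpha>(m m')\<close>, and every bialgebroid axiom
  becomes an identity between functions on \<open>M\<close>.

  For the invariants, left depth two writes each endomorphism of \<open>M\<^sub>N\<close> as a finite sum
  \<open>\<Sum>\<^sub>j \<lambda>(x\<^sub>j) \<beta>\<^sub>j\<close> with \<open>\<beta>\<^sub>j \<in> A\<close>; since \<open>\<beta>(m x) = \<beta>(m) x\<close> for invariant \<open>x\<close>, right multiplication by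
  \<open>x\<close> commutes with \<open>End(M\<^sub>N)\<close> and so comes from \<open>N\<close> when \<open>M\<^sub>N\<close> is balanced.\<close>

section \<open>Tensor products of bimodules\<close>

text \<open>The obstacle is equality in \<open>A \<otimes>\<^sub>R A\<close>: its elements are
  cosets of formal sums, and the defining relations give no normal form by which two of them could
  be compared. The quasibasis overcomes this because it hides a dual basis of \<open>A\<close> as a
  right \<open>R\<close>-module. Since \<open>c\<^sub>i\<close> commutes with \<open>N\<close>, the
  element \<open>c\<^sub>i\<^sup>1 a(c\<^sub>i\<^sup>2)\<close> lies in \<open>R\<close>; it depends
  right \<open>R\<close>-linearly on \<open>a\<close>, and \<open>a = \<Sum>\<^sub>i
  \<gamma>\<^sub>i \<cdot> c\<^sub>i\<^sup>1 a(c\<^sub>i\<^sup>2)\<close>. Hence the coefficient of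
  \<open>\<gamma>\<^sub>i\<close> in a tensor exists by the universal property, before anything is
  known about values; that it can be computed from values alone is then checked on pure tensors.
  Well-definedness is settled in the same way. A lift out of a tensor product has a meaning only for
  a balanced map, and for nested lifts (reassociation, the product of two comultiplications) balance
  is verified by comparing values.\<close>

lemma (in abelian_group_hom) hom_finsum:
  assumes "f \<in> A \<rightarrow> carrier G"
  shows "h (\<Oplus>\<^bsub>G\<^esub>i\<in>A. f i) = (\<Oplus>\<^bsub>H\<^esub>i\<in>A. h (f i))"
  using assms
proof (induction A rule: infinite_finite_induct)
  case (insert x A)
  then have "f x \<in> carrier G" "f \<in> A \<rightarrow> carrier G" by auto
  with insert show ?case
    by (simp add: G.finsum_insert H.finsum_insert G.finsum_closed Pi_def)
qed (simp_all add: G.finsum_infinite H.finsum_infinite)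

lemma abelian_group_homI_additive:
  assumes "abelian_group G" "abelian_group H"
    and "\<And>x. x \<in> carrier G \<Longrightarrow> f x \<in> carrier H"
    and "\<And>x y. \<lbrakk>x \<in> carrier G; y \<in> carrier G\<rbrakk> \<Longrightarrow> f (x \<oplus>\<^bsub>G\<^esub> y) = f x \<oplus>\<^bsub>H\<^esub> f y"
  shows "abelian_group_hom G H f"
proof -
  interpret G: abelian_group G by fact
  interpret H: abelian_group H by fact
  show ?thesis
    by (intro abelian_group_homI G.abelian_group_axioms H.abelian_group_axioms group_hom.intro
        group_hom_axioms.intro G.a_group H.a_group homI) (use assms in auto)
qed

section \<open>Evaluation of formal integer combinations in an abelian group\<close>

definition frag_sum :: "('g, 'k) ring_scheme \<Rightarrow> ('z \<Rightarrow> 'g) \<Rightarrow> ('z \<Rightarrow>\<^sub>0 int) \<Rightarrow> 'g" where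
  "frag_sum G f p = (\<Oplus>\<^bsub>G\<^esub>z\<in>Poly_Mapping.keys p. [Poly_Mapping.lookup p z] \<cdot>\<^bsub>G\<^esub> f z)"

context abelian_group
begin

lemma finsum_subgroup:
  assumes "subgroup P (add_monoid G)" "\<And>j. j \<in> J \<Longrightarrow> g j \<in> P"
  shows "(\<Oplus>j\<in>J. g j) \<in> P"
proof -
  interpret P: subgroup P "add_monoid G" by fact
  have sub: "P \<subseteq> carrier G" using P.subset by simp
  show ?thesis using assms(2)
  proof (induction J rule: infinite_finite_induct)
    case (insert j J)
    then have "(\<Oplus>j\<in>insert j J. g j) = g j \<oplus> (\<Oplus>j\<in>J. g j)"
      using sub by (intro finsum_insert) auto
    then show ?case using insert P.m_closed by simp
  qed (use P.one_closed in \<open>simp_all add: finsum_infinite\<close>)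
qed

lemma add_pow_0: "[(0::int)] \<cdot> x = \<zero>"
  by (simp add: add_pow_def)

lemma eq_if_minus_zero: "\<lbrakk>x \<in> carrier G; y \<in> carrier G; x \<ominus> y = \<zero>\<rbrakk> \<Longrightarrow> x = y"
  by (metis a_inv_closed a_minus_def add.inv_equality minus_minus)

text \<open>Keys can cancel in \<open>p + q\<close>, so additivity has to compare three sums with
  different supports. Over a common larger index set the extra terms are multiples by 0.\<close>

lemma frag_sum_superset:
  assumes "f \<in> S \<rightarrow> carrier G" "finite K" "Poly_Mapping.keys p \<subseteq> K" "K \<subseteq> S"
  shows "frag_sum G f p = (\<Oplus>z\<in>K. [Poly_Mapping.lookup p z] \<cdot> f z)"
  unfolding frag_sum_def
  by (rule add.finprod_mono_neutral_cong_left[OF assms(2,3)])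
    (use assms in \<open>auto simp: in_keys_iff Pi_def subset_eq add_pow_0\<close>)

lemma frag_sum_closed:
  assumes "f \<in> S \<rightarrow> carrier G" "Poly_Mapping.keys p \<subseteq> S"
  shows "frag_sum G f p \<in> carrier G"
  unfolding frag_sum_def by (rule finsum_closed) (use assms in \<open>auto simp: Pi_def subset_eq\<close>)

lemma frag_sum_add:
  assumes f: "f \<in> S \<rightarrow> carrier G" and p: "Poly_Mapping.keys p \<subseteq> S" and q: "Poly_Mapping.keys q \<subseteq> S"
  shows "frag_sum G f (p + q) = frag_sum G f p \<oplus> frag_sum G f q"
proof -
  let ?K = "Poly_Mapping.keys p \<union> Poly_Mapping.keys q"
  have K: "finite ?K" "?K \<subseteq> S" using p q by auto
  then have cl: "z \<in> ?K \<Longrightarrow> f z \<in> carrier G" for z using f by auto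
  have "frag_sum G f (p + q) = (\<Oplus>z\<in>?K. [Poly_Mapping.lookup (p + q) z] \<cdot> f z)"
    by (rule frag_sum_superset[OF f K(1) _ K(2)]) (rule Poly_Mapping.keys_add)
  also have "\<dots> = (\<Oplus>z\<in>?K. [Poly_Mapping.lookup p z] \<cdot> f z \<oplus> [Poly_Mapping.lookup q z] \<cdot> f z)"
    by (rule finsum_cong') (use cl in \<open>auto simp: lookup_add add.int_pow_mult\<close>)
  also have "\<dots> = (\<Oplus>z\<in>?K. [Poly_Mapping.lookup p z] \<cdot> f z) \<oplus> (\<Oplus>z\<in>?K. [Poly_Mapping.lookup q z] \<cdot> f z)"
    by (rule finsum_addf) (use cl in auto)
  also have "\<dots> = frag_sum G f p \<oplus> frag_sum G f q"
    by (simp add: frag_sum_superset[OF f K(1) _ K(2)])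
  finally show ?thesis .
qed

lemma frag_sum_of: "f z \<in> carrier G \<Longrightarrow> frag_sum G f (frag_of z) = f z"
  by (simp add: frag_sum_def finsum_insert[of "{}", simplified])

lemma frag_sum_hom:
  assumes "f \<in> S \<rightarrow> carrier G"
  shows "group_hom (free_Abelian_group S) (add_monoid G) (frag_sum G f)"
  by (intro group_hom.intro group_hom_axioms.intro homI a_group)
    (use assms in \<open>auto simp: frag_sum_add frag_sum_closed\<close>)

lemma frag_sum_diff:
  assumes f: "f \<in> S \<rightarrow> carrier G" and p: "Poly_Mapping.keys p \<subseteq> S" and q: "Poly_Mapping.keys q \<subseteq> S"
  shows "frag_sum G f (p - q) = frag_sum G f p \<ominus> frag_sum G f q"
proof -
  interpret group_hom "free_Abelian_group S" "add_monoid G" "frag_sum G f"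
    by (rule frag_sum_hom[OF f])
  have "frag_sum G f (- q) = \<ominus> frag_sum G f q"
    using hom_inv[of q] q by (simp add: a_inv_def)
  then have "frag_sum G f (p + - q) = frag_sum G f p \<oplus> \<ominus> frag_sum G f q"
    using frag_sum_add[OF f p, of "- q"] q by simp
  then show ?thesis by (simp add: a_minus_def)
qed

end

text \<open>These laws make the tensor product and its two outer actions well defined. Laws about
  sums and products of scalars are derived later, by evaluation, for the modules to which
  \<open>coeff\<close> applies.\<close>

locale bimodule = X?: abelian_group X
  for S :: "('s, 'k1) ring_scheme" and T :: "('t, 'k2) ring_scheme" and X :: "('s, 't, 'x) bimodule" +
  assumes lact_closed: "\<lbrakk>s \<in> carrier S; x \<in> carrier X\<rbrakk> \<Longrightarrow> lact X s x \<in> carrier X"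
    and ract_closed: "\<lbrakk>t \<in> carrier T; x \<in> carrier X\<rbrakk> \<Longrightarrow> ract X x t \<in> carrier X"
    and lact_add: "\<lbrakk>s \<in> carrier S; x \<in> carrier X; x' \<in> carrier X\<rbrakk> \<Longrightarrow>
      lact X s (x \<oplus>\<^bsub>X\<^esub> x') = lact X s x \<oplus>\<^bsub>X\<^esub> lact X s x'"
    and ract_add: "\<lbrakk>t \<in> carrier T; x \<in> carrier X; x' \<in> carrier X\<rbrakk> \<Longrightarrow>
      ract X (x \<oplus>\<^bsub>X\<^esub> x') t = ract X x t \<oplus>\<^bsub>X\<^esub> ract X x' t"
    and lact_ract: "\<lbrakk>s \<in> carrier S; t \<in> carrier T; x \<in> carrier X\<rbrakk> \<Longrightarrow>
      lact X s (ract X x t) = ract X (lact X s x) t"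

text \<open>Biadditivity and balance say that the additive extension of \<open>b\<close> to formal
  sums kills \<open>tensor_relators\<close>; this is what gives \<open>tensor_lift\<close> a
  meaning.\<close>

definition balanced_map ::
  "('t, 'k1) ring_scheme \<Rightarrow> ('s, 't, 'x) bimodule \<Rightarrow> ('t, 'u, 'y) bimodule \<Rightarrow> ('g, 'k2) ring_scheme \<Rightarrow>
   ('x \<Rightarrow> 'y \<Rightarrow> 'g) \<Rightarrow> bool" where
  "balanced_map T X Y G b \<longleftrightarrow>
    (\<forall>x\<in>carrier X. \<forall>y\<in>carrier Y. b x y \<in> carrier G) \<and>
    (\<forall>x\<in>carrier X. \<forall>x'\<in>carrier X. \<forall>y\<in>carrier Y. b (x \<oplus>\<^bsub>X\<^esub> x') y = b x y \<oplus>\<^bsub>G\<^esub> b x' y) \<and>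
    (\<forall>x\<in>carrier X. \<forall>y\<in>carrier Y. \<forall>y'\<in>carrier Y. b x (y \<oplus>\<^bsub>Y\<^esub> y') = b x y \<oplus>\<^bsub>G\<^esub> b x y') \<and>
    (\<forall>x\<in>carrier X. \<forall>t\<in>carrier T. \<forall>y\<in>carrier Y. b (ract X x t) y = b x (lact Y t y))"

lemma balanced_mapI:
  assumes "\<And>x y. \<lbrakk>x \<in> carrier X; y \<in> carrier Y\<rbrakk> \<Longrightarrow> b x y \<in> carrier G"
    and "\<And>x x' y. \<lbrakk>x \<in> carrier X; x' \<in> carrier X; y \<in> carrier Y\<rbrakk> \<Longrightarrow> b (x \<oplus>\<^bsub>X\<^esub> x') y = b x y \<oplus>\<^bsub>G\<^esub> b x' y"
    and "\<And>x y y'. \<lbrakk>x \<in> carrier X; y \<in> carrier Y; y' \<in> carrier Y\<rbrakk> \<Longrightarrow> b x (y \<oplus>\<^bsub>Y\<^esub> y') = b x y \<oplus>\<^bsub>G\<^esub> b x y'"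
    and "\<And>x t y. \<lbrakk>x \<in> carrier X; t \<in> carrier T; y \<in> carrier Y\<rbrakk> \<Longrightarrow> b (ract X x t) y = b x (lact Y t y)"
  shows "balanced_map T X Y G b"
  using assms by (simp add: balanced_map_def)

section \<open>Tensor products: presentation, induction, universal property and outer
  actions\<close>

locale tensor_product = X: bimodule S T X + Y: bimodule T U Y
  for S :: "('s, 'k1) ring_scheme" and T :: "('t, 'k2) ring_scheme" and U :: "('u, 'k3) ring_scheme"
    and X :: "('s, 't, 'x) bimodule" and Y :: "('t, 'u, 'y) bimodule"
begin

abbreviation "F \<equiv> tensor_free X Y"
abbreviation "K \<equiv> tensor_kernel T X Y"
abbreviation "XY \<equiv> tensor T X Y"
abbreviation "pt \<equiv> pure_tensor T X Y"

lemma relators_closed: "tensor_relators T X Y \<subseteq> carrier F"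
proof -
  have "Poly_Mapping.keys (frag_of a - frag_of b) \<subseteq> {a, b}"
    "Poly_Mapping.keys (frag_of a - frag_of b - frag_of d) \<subseteq> {a, b, d}" for a b d :: "'x \<times> 'y"
    using keys_diff[of "frag_of a" "frag_of b"] keys_diff[of "frag_of a - frag_of b" "frag_of d"] by auto
  then show ?thesis
    unfolding tensor_relators_def
    by (auto simp: X.ract_closed Y.lact_closed dest!: rev_subsetD[OF _ keys_diff])
qed

lemma kernel_normal: "K \<lhd> F"
proof -
  interpret F: comm_group F by (rule abelian_free_Abelian_group)
  show ?thesis
    unfolding tensor_kernel_def
    by (rule F.subgroup_imp_normal[OF F.generate_is_subgroup[OF relators_closed]])
qed

sublocale K: normal K F by (rule kernel_normal)

lemma tensor_simps:
  "carrier XY = rcosets\<^bsub>F\<^esub> K" "add XY = (<#>\<^bsub>F\<^esub>)" "zero XY = K"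
  by (simp_all add: tensor_def bimod_of_def tensor_group_def FactGroup_def Let_def)

lemma abelian_group_tensor: "abelian_group XY"
proof -
  interpret Q: comm_group "F Mod K"
    by (rule comm_group.abelian_FactGroup[OF abelian_free_Abelian_group K.is_subgroup])
  show ?thesis
  proof (rule abelian_groupI)
    show "x \<oplus>\<^bsub>XY\<^esub> y \<in> carrier XY" "x \<oplus>\<^bsub>XY\<^esub> y = y \<oplus>\<^bsub>XY\<^esub> x"
      if "x \<in> carrier XY" "y \<in> carrier XY" for x y
      using that Q.m_closed Q.m_comm by (auto simp: tensor_simps FactGroup_def)
    show "\<zero>\<^bsub>XY\<^esub> \<in> carrier XY" using Q.one_closed by (simp add: tensor_simps FactGroup_def)
    show "x \<oplus>\<^bsub>XY\<^esub> y \<oplus>\<^bsub>XY\<^esub> z = x \<oplus>\<^bsub>XY\<^esub> (y \<oplus>\<^bsub>XY\<^esub> z)"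
      if "x \<in> carrier XY" "y \<in> carrier XY" "z \<in> carrier XY" for x y z
      using that Q.m_assoc by (auto simp: tensor_simps FactGroup_def)
    show "\<zero>\<^bsub>XY\<^esub> \<oplus>\<^bsub>XY\<^esub> x = x" if "x \<in> carrier XY" for x
      using that Q.l_one by (auto simp: tensor_simps FactGroup_def)
    show "\<exists>y\<in>carrier XY. y \<oplus>\<^bsub>XY\<^esub> x = \<zero>\<^bsub>XY\<^esub>" if "x \<in> carrier XY" for x
      using that Q.l_inv_ex by (auto simp: tensor_simps FactGroup_def)
  qed
qed

sublocale XY: abelian_group XY by (rule abelian_group_tensor)

definition "cls p = K #>\<^bsub>F\<^esub> p"

lemma cls_hom: "\<lbrakk>p \<in> carrier F; q \<in> carrier F\<rbrakk> \<Longrightarrow> cls (p + q) = cls p \<oplus>\<^bsub>XY\<^esub> cls q"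
  using K.rcos_sum[of p q] by (simp add: cls_def tensor_simps)

lemma cls_closed: "p \<in> carrier F \<Longrightarrow> cls p \<in> carrier XY"
  by (auto simp: cls_def tensor_simps RCOSETS_def)

lemma cls_group_hom: "group_hom F (add_monoid XY) cls"
  by (intro group_hom.intro group_hom_axioms.intro homI XY.a_group)
    (use cls_hom cls_closed in auto)

lemma cls_diff: "\<lbrakk>p \<in> carrier F; q \<in> carrier F\<rbrakk> \<Longrightarrow> cls (p - q) = cls p \<ominus>\<^bsub>XY\<^esub> cls q"
proof -
  interpret group_hom F "add_monoid XY" cls by (rule cls_group_hom)
  assume p: "p \<in> carrier F" and q: "q \<in> carrier F"
  have "cls (- q) = \<ominus>\<^bsub>XY\<^esub> cls q" using hom_inv[of q] q by (simp add: a_inv_def)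
  then show ?thesis using cls_hom[of p "- q"] p q by (simp add: a_minus_def)
qed

lemma cls_relator: "p \<in> tensor_relators T X Y \<Longrightarrow> cls p = \<zero>\<^bsub>XY\<^esub>"
  unfolding cls_def tensor_simps
  by (rule K.coset_join2) (use subsetD[OF relators_closed] K.is_subgroup in \<open>auto simp del: carrier_free_Abelian_group_iff simp: tensor_kernel_def intro: generate.incl\<close>)

lemma pure_eq_cls: "pt x y = cls (frag_of (x, y))"
  by (simp add: pure_tensor_def cls_def)

lemma pure_closed: "\<lbrakk>x \<in> carrier X; y \<in> carrier Y\<rbrakk> \<Longrightarrow> pt x y \<in> carrier XY"
  by (simp add: pure_eq_cls cls_closed)

lemma pure_add_left:
  assumes "x \<in> carrier X" "x' \<in> carrier X" "y \<in> carrier Y"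
  shows "pt (x \<oplus>\<^bsub>X\<^esub> x') y = pt x y \<oplus>\<^bsub>XY\<^esub> pt x' y"
proof -
  let ?a = "frag_of (x \<oplus>\<^bsub>X\<^esub> x', y)" and ?b = "frag_of (x, y)" and ?c = "frag_of (x', y)"
  have cl: "?a \<in> carrier F" "?b \<in> carrier F" "?c \<in> carrier F" using assms by auto
  have r: "?a - (?b + ?c) \<in> tensor_relators T X Y"
    using assms unfolding tensor_relators_def diff_diff_eq[symmetric] by blast
  have bc: "?b + ?c \<in> carrier F" using K.m_closed[OF cl(2,3)] by simp
  have "cls ?a \<ominus>\<^bsub>XY\<^esub> cls (?b + ?c) = \<zero>\<^bsub>XY\<^esub>"
    using cls_relator[OF r] cls_diff[OF cl(1) bc] by simp
  then have "cls ?a = cls (?b + ?c)" using cl(1) bc by (simp add: cls_closed XY.eq_if_minus_zero)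
  then show ?thesis using cls_hom[OF cl(2,3)] by (simp add: pure_eq_cls)
qed

lemma pure_add_right:
  assumes "x \<in> carrier X" "y \<in> carrier Y" "y' \<in> carrier Y"
  shows "pt x (y \<oplus>\<^bsub>Y\<^esub> y') = pt x y \<oplus>\<^bsub>XY\<^esub> pt x y'"
proof -
  let ?a = "frag_of (x, y \<oplus>\<^bsub>Y\<^esub> y')" and ?b = "frag_of (x, y)" and ?c = "frag_of (x, y')"
  have cl: "?a \<in> carrier F" "?b \<in> carrier F" "?c \<in> carrier F" using assms by auto
  have r: "?a - (?b + ?c) \<in> tensor_relators T X Y"
    using assms unfolding tensor_relators_def diff_diff_eq[symmetric] by blast
  have bc: "?b + ?c \<in> carrier F" using K.m_closed[OF cl(2,3)] by simp
  have "cls ?a \<ominus>\<^bsub>XY\<^esub> cls (?b + ?c) = \<zero>\<^bsub>XY\<^esub>"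
    using cls_relator[OF r] cls_diff[OF cl(1) bc] by simp
  then have "cls ?a = cls (?b + ?c)" using cl(1) bc by (simp add: cls_closed XY.eq_if_minus_zero)
  then show ?thesis using cls_hom[OF cl(2,3)] by (simp add: pure_eq_cls)
qed

lemma pure_balanced:
  assumes "x \<in> carrier X" "t \<in> carrier T" "y \<in> carrier Y"
  shows "pt (ract X x t) y = pt x (lact Y t y)"
proof -
  let ?a = "frag_of (ract X x t, y)" and ?b = "frag_of (x, lact Y t y)"
  have cl: "?a \<in> carrier F" "?b \<in> carrier F" using assms by (auto simp: X.ract_closed Y.lact_closed)
  have r: "?a - ?b \<in> tensor_relators T X Y" using assms unfolding tensor_relators_def by blast
  have "cls ?a = cls ?b"
    using cls_relator[OF r] cls_diff[OF cl] cl by (simp add: cls_closed XY.eq_if_minus_zero)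
  then show ?thesis by (simp add: pure_eq_cls)
qed

lemma pure_left_hom: "y \<in> carrier Y \<Longrightarrow> abelian_group_hom X XY (\<lambda>x. pt x y)"
  by (intro abelian_group_homI_additive X.abelian_group_axioms XY.abelian_group_axioms)
    (auto simp: pure_closed pure_add_left)

lemma pure_right_hom: "x \<in> carrier X \<Longrightarrow> abelian_group_hom Y XY (pt x)"
  by (intro abelian_group_homI_additive Y.abelian_group_axioms XY.abelian_group_axioms)
    (auto simp: pure_closed pure_add_right)

text \<open>Sums of pure tensors exhaust the tensor product without a case for negatives, because
  \<open>- (x \<otimes> y) = (- x) \<otimes> y\<close>.\<close>

lemma tensor_induct [consumes 1, case_names pure add]:
  assumes q: "q \<in> carrier XY"
    and pure: "\<And>x y. \<lbrakk>x \<in> carrier X; y \<in> carrier Y\<rbrakk> \<Longrightarrow> P (pt x y)"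
    and add: "\<And>q q'. \<lbrakk>q \<in> carrier XY; q' \<in> carrier XY; P q; P q'\<rbrakk> \<Longrightarrow> P (q \<oplus>\<^bsub>XY\<^esub> q')"
  shows "P q"
proof -
  \<comment> \<open>\<open>frag_induction\<close> builds formal sums by differences, so the property
    has to be carried for a class and its negative together.\<close>
  define P' where "P' q \<longleftrightarrow> P q \<and> P (\<ominus>\<^bsub>XY\<^esub> q)" for q
  obtain p where p: "p \<in> carrier F" "q = cls p"
    using q by (auto simp: tensor_simps cls_def RCOSETS_def)
  have "Poly_Mapping.keys p \<subseteq> carrier X \<times> carrier Y" using p by simp
  then have "P' (cls p) \<and> p \<in> carrier F"
  proof (induction p rule: frag_induction)
    case zero
    interpret abelian_group_hom X XY "\<lambda>x. pt x \<zero>\<^bsub>Y\<^esub>" by (rule pure_left_hom) simp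
    have "P (pt \<zero>\<^bsub>X\<^esub> \<zero>\<^bsub>Y\<^esub>)" by (rule pure) auto
    then have z: "P \<zero>\<^bsub>XY\<^esub>" by simp
    have c0: "cls 0 = \<zero>\<^bsub>XY\<^esub>" using cls_hom[of 0 0] cls_closed[of 0] by (simp add: XY.add.r_cancel_one')
    have "\<ominus>\<^bsub>XY\<^esub> \<zero>\<^bsub>XY\<^esub> = \<zero>\<^bsub>XY\<^esub>"
      by (metis XY.r_neg XY.l_zero XY.zero_closed XY.a_inv_closed)
    with z have "P (\<ominus>\<^bsub>XY\<^esub> \<zero>\<^bsub>XY\<^esub>)" by (simp only:)
    with z c0 show ?case by (simp only: P'_def) simp
  next
    case (one z)
    then obtain x y where z: "z = (x, y)" "x \<in> carrier X" "y \<in> carrier Y" by auto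
    interpret abelian_group_hom X XY "\<lambda>x. pt x y" by (rule pure_left_hom) fact
    have "P (pt (\<ominus>\<^bsub>X\<^esub> x) y)" using z by (intro pure) auto
    moreover have "pt (\<ominus>\<^bsub>X\<^esub> x) y = \<ominus>\<^bsub>XY\<^esub> pt x y" using z by simp
    ultimately have "P (\<ominus>\<^bsub>XY\<^esub> pt x y)" by (simp only:)
    then show ?case using z pure[of x y] by (simp add: P'_def pure_eq_cls)
  next
    case (diff p q)
    then have cl: "p \<in> carrier F" "q \<in> carrier F" by auto
    moreover have "p - q \<in> carrier F"
      using K.m_closed[OF cl(1) K.inv_closed[OF cl(2)]] cl(2) by simp
    moreover have "P (cls p \<oplus>\<^bsub>XY\<^esub> \<ominus>\<^bsub>XY\<^esub> cls q)" "P (\<ominus>\<^bsub>XY\<^esub> cls p \<oplus>\<^bsub>XY\<^esub> cls q)"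
      using diff cl by (auto intro!: add simp: P'_def cls_closed)
    ultimately show ?case
      by (simp only: P'_def cls_diff) (simp add: XY.minus_add a_minus_def cls_closed)
  qed
  then show ?thesis using p by (simp add: P'_def)
qed

lemma hom_eqI:
  assumes "abelian_group_hom XY G f" "abelian_group_hom XY G g"
    and "\<And>x y. \<lbrakk>x \<in> carrier X; y \<in> carrier Y\<rbrakk> \<Longrightarrow> f (pt x y) = g (pt x y)"
    and "q \<in> carrier XY"
  shows "f q = g q"
proof -
  interpret f: abelian_group_hom XY G f by fact
  interpret g: abelian_group_hom XY G g by fact
  show ?thesis
    using assms(4) by (induction q rule: tensor_induct) (simp_all add: assms(3))
qed

text \<open>The universal property. The kernel of \<open>frag_sum\<close> is a subgroup containing
  all relators, hence all of \<open>K\<close>; so \<open>frag_sum\<close> is constant on each coset,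
  and \<open>the_elem\<close> in \<open>tensor_lift\<close> picks that one value.\<close>

lemma lift_cls:
  assumes "abelian_group G" and b: "balanced_map T X Y G b" and p: "p \<in> carrier F"
  shows "tensor_lift G b (cls p) = frag_sum G (\<lambda>z. b (fst z) (snd z)) p"
proof -
  interpret G: abelian_group G by fact
  let ?f = "\<lambda>z. b (fst z) (snd z)" and ?S = "carrier X \<times> carrier Y"
  have f: "?f \<in> ?S \<rightarrow> carrier G" using b by (auto simp: balanced_map_def)
  have bcl: "b x y \<in> carrier G" if "x \<in> carrier X" "y \<in> carrier Y" for x y
    using b that by (simp add: balanced_map_def)
  interpret \<phi>: group_hom F "add_monoid G" "frag_sum G ?f"
    by (rule G.frag_sum_hom[OF f])
  have of: "frag_sum G ?f (frag_of (x, y)) = b x y" if "x \<in> carrier X" "y \<in> carrier Y" for x y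
    using that b by (subst G.frag_sum_of) (auto simp: balanced_map_def)
  have diff: "frag_sum G ?f (a - b) = frag_sum G ?f a \<ominus>\<^bsub>G\<^esub> frag_sum G ?f b"
    if "a \<in> carrier F" "b \<in> carrier F" for a b
    using G.frag_sum_diff[OF f] that by simp
  have diffF: "a - b \<in> carrier F" if "a \<in> carrier F" "b \<in> carrier F" for a b
    using K.m_closed[OF that(1) K.inv_closed[OF that(2)]] that(2) by simp
  have diff2: "frag_sum G ?f (a - b - d) = frag_sum G ?f a \<ominus>\<^bsub>G\<^esub> frag_sum G ?f b \<ominus>\<^bsub>G\<^esub> frag_sum G ?f d"
    if "a \<in> carrier F" "b \<in> carrier F" "d \<in> carrier F" for a b d
    using diff[OF diffF] diff that by simp
  have 0: "frag_sum G ?f r = \<zero>\<^bsub>G\<^esub>" if "r \<in> tensor_relators T X Y" for r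
    using that unfolding tensor_relators_def
  proof (elim UnE CollectE exE conjE)
    fix x x' y assume r: "r = frag_of (x \<oplus>\<^bsub>X\<^esub> x', y) - frag_of (x, y) - frag_of (x', y)"
      and x: "x \<in> carrier X" "x' \<in> carrier X" "y \<in> carrier Y"
    have b': "b (x \<oplus>\<^bsub>X\<^esub> x') y = b x y \<oplus>\<^bsub>G\<^esub> b x' y" using b x by (simp add: balanced_map_def)
    show ?thesis unfolding r
      using x bcl[OF x(1,3)] bcl[OF x(2,3)]
      by (subst diff2) (simp_all add: of b' a_minus_def G.a_ac G.r_neg G.r_neg1)
  next
    fix x y y' assume r: "r = frag_of (x, y \<oplus>\<^bsub>Y\<^esub> y') - frag_of (x, y) - frag_of (x, y')"
      and x: "x \<in> carrier X" "y \<in> carrier Y" "y' \<in> carrier Y"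
    have b': "b x (y \<oplus>\<^bsub>Y\<^esub> y') = b x y \<oplus>\<^bsub>G\<^esub> b x y'" using b x by (simp add: balanced_map_def)
    show ?thesis unfolding r
      using x bcl[OF x(1,2)] bcl[OF x(1,3)]
      by (subst diff2) (simp_all add: of b' a_minus_def G.a_ac G.r_neg G.r_neg1)
  next
    fix x t y assume r: "r = frag_of (ract X x t, y) - frag_of (x, lact Y t y)"
      and x: "x \<in> carrier X" "t \<in> carrier T" "y \<in> carrier Y"
    have b': "b (ract X x t) y = b x (lact Y t y)" using b x by (simp add: balanced_map_def)
    show ?thesis unfolding r
      using x by (subst diff) (simp_all add: of b' X.ract_closed Y.lact_closed bcl a_minus_def G.r_neg)
  qed
  have K0: "frag_sum G ?f k = \<zero>\<^bsub>G\<^esub>" if "k \<in> K" for k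
  proof -
    have "kernel F (add_monoid G) (frag_sum G ?f) \<supseteq> tensor_relators T X Y"
      using subsetD[OF relators_closed] 0
      by (auto simp: kernel_def simp del: carrier_free_Abelian_group_iff)
    from K.generate_subgroup_incl[OF this \<phi>.subgroup_kernel]
    show ?thesis using that by (auto simp: tensor_kernel_def kernel_def)
  qed
  have "frag_sum G ?f ` cls p = {frag_sum G ?f p}"
  proof -
    have "frag_sum G ?f (k + p) = frag_sum G ?f p" if "k \<in> K" for k
      using \<phi>.hom_mult[of k p] K0[OF that] p K.subset that \<phi>.hom_closed[OF p] by auto
    moreover have "cls p = (\<lambda>k. k + p) ` K" by (auto simp: cls_def r_coset_def)
    moreover have "K \<noteq> {}" using subgroup.one_closed[OF K.is_subgroup] by blast
    ultimately show ?thesis by (simp add: image_image image_constant_conv cong: image_cong_simp)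
  qed
  then show ?thesis unfolding tensor_lift_def frag_sum_def by simp
qed

lemma lift_hom:
  assumes "abelian_group G" "balanced_map T X Y G b"
  shows "abelian_group_hom XY G (tensor_lift G b)"
proof (rule abelian_group_homI_additive[OF XY.abelian_group_axioms assms(1)])
  interpret G: abelian_group G by fact
  let ?f = "\<lambda>z. b (fst z) (snd z)" and ?S = "carrier X \<times> carrier Y"
  have f: "?f \<in> ?S \<rightarrow> carrier G" using assms(2) by (auto simp: balanced_map_def)
  have rep: "\<exists>p\<in>carrier F. q = cls p" if "q \<in> carrier XY" for q
    using that by (auto simp: tensor_simps cls_def RCOSETS_def)
  show "tensor_lift G b q \<in> carrier G" if "q \<in> carrier XY" for q
    using rep[OF that] G.frag_sum_closed[OF f] by (auto simp: lift_cls[OF assms])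
  show "tensor_lift G b (q \<oplus>\<^bsub>XY\<^esub> q') = tensor_lift G b q \<oplus>\<^bsub>G\<^esub> tensor_lift G b q'"
    if q: "q \<in> carrier XY" "q' \<in> carrier XY" for q q'
  proof -
    obtain p p' where p: "p \<in> carrier F" "q = cls p" "p' \<in> carrier F" "q' = cls p'"
      using rep[OF q(1)] rep[OF q(2)] by blast
    have "p + p' \<in> carrier F" using K.m_closed[OF p(1,3)] by simp
    then show ?thesis
      using p G.frag_sum_add[OF f, of p p'] by (simp add: lift_cls[OF assms] flip: cls_hom)
  qed
qed

lemma lift_pure:
  assumes "abelian_group G" "balanced_map T X Y G b" "x \<in> carrier X" "y \<in> carrier Y"
  shows "tensor_lift G b (pt x y) = b x y"
proof -
  interpret G: abelian_group G by fact
  show ?thesis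
    using assms by (simp add: pure_eq_cls lift_cls G.frag_sum_of balanced_map_def)
qed

lemma lift_closed:
  "\<lbrakk>abelian_group G; balanced_map T X Y G b; q \<in> carrier XY\<rbrakk> \<Longrightarrow> tensor_lift G b q \<in> carrier G"
  using abelian_group_hom.hom_closed[OF lift_hom] .

lemma lift_add:
  "\<lbrakk>abelian_group G; balanced_map T X Y G b; q \<in> carrier XY; q' \<in> carrier XY\<rbrakk> \<Longrightarrow>
    tensor_lift G b (q \<oplus>\<^bsub>XY\<^esub> q') = tensor_lift G b q \<oplus>\<^bsub>G\<^esub> tensor_lift G b q'"
  using abelian_group_hom.hom_add[OF lift_hom] .

text \<open>Balance passes from \<open>b\<close> to \<open>b'\<close> because the actions preserve
  the carriers. This permits rewriting under a lift with identities that hold only on the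
  carriers.\<close>

lemma lift_cong:
  assumes "abelian_group G" "balanced_map T X Y G b" "q \<in> carrier XY"
    and eq: "\<And>x y. \<lbrakk>x \<in> carrier X; y \<in> carrier Y\<rbrakk> \<Longrightarrow> b' x y = b x y"
  shows "tensor_lift G b' q = tensor_lift G b q"
proof -
  have "balanced_map T X Y G b'"
    using assms(2) by (simp add: balanced_map_def eq X.ract_closed Y.lact_closed)
  then show ?thesis
    using assms by (intro hom_eqI[of G "tensor_lift G b'" "tensor_lift G b" q] lift_hom) (auto simp: lift_pure)
qed

text \<open>\<open>tensor\<close> defines its actions by lifts into the bare group, before the
  bimodule record exists. The same group thus occurs under two records, and facts about lifts have
  to be moved from \<open>TG\<close> to \<open>XY\<close>.\<close>

abbreviation "TG \<equiv> tensor_group T X Y"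

lemma tensor_group_simps:
  "carrier TG = carrier XY" "add TG = add XY" "zero TG = zero XY"
  by (simp_all add: tensor_def bimod_of_def Let_def)

lemma abelian_group_tensor_group: "abelian_group TG"
  by (rule abelian_groupI)
    (auto simp: tensor_group_simps XY.a_ac intro: bexI[of _ "\<ominus>\<^bsub>XY\<^esub> x" for x] XY.l_neg)

lemma lact_tensor: "lact XY s = tensor_lift TG (\<lambda>x y. pt (lact X s x) y)"
  and ract_tensor: "ract XY q u = tensor_lift TG (\<lambda>x y. pt x (ract Y y u)) q"
  by (simp_all add: tensor_def bimod_of_def Let_def)

lemma lact_balanced: "s \<in> carrier S \<Longrightarrow> balanced_map T X Y TG (\<lambda>x y. pt (lact X s x) y)"
  by (intro balanced_mapI)
    (auto simp: tensor_group_simps pure_closed X.lact_closed X.lact_add pure_add_left pure_add_right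
      X.lact_ract pure_balanced)

lemma ract_balanced: "u \<in> carrier U \<Longrightarrow> balanced_map T X Y TG (\<lambda>x y. pt x (ract Y y u))"
  by (intro balanced_mapI)
    (auto simp: tensor_group_simps pure_closed Y.ract_closed Y.ract_add pure_add_left pure_add_right
      pure_balanced simp flip: Y.lact_ract)

lemma lact_pure: "\<lbrakk>s \<in> carrier S; x \<in> carrier X; y \<in> carrier Y\<rbrakk> \<Longrightarrow> lact XY s (pt x y) = pt (lact X s x) y"
  by (simp add: lact_tensor lift_pure[OF abelian_group_tensor_group lact_balanced])

lemma ract_pure: "\<lbrakk>u \<in> carrier U; x \<in> carrier X; y \<in> carrier Y\<rbrakk> \<Longrightarrow> ract XY (pt x y) u = pt x (ract Y y u)"
  by (simp add: ract_tensor lift_pure[OF abelian_group_tensor_group ract_balanced])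

sublocale XY: bimodule S U XY
proof
  show l: "lact XY s q \<in> carrier XY" if "s \<in> carrier S" "q \<in> carrier XY" for s q
    using lift_closed[OF abelian_group_tensor_group lact_balanced] that
    by (simp add: lact_tensor tensor_group_simps)
  show r: "ract XY q u \<in> carrier XY" if "u \<in> carrier U" "q \<in> carrier XY" for u q
    using lift_closed[OF abelian_group_tensor_group ract_balanced] that
    by (simp add: ract_tensor tensor_group_simps)
  show la: "lact XY s (q \<oplus>\<^bsub>XY\<^esub> q') = lact XY s q \<oplus>\<^bsub>XY\<^esub> lact XY s q'"
    if "s \<in> carrier S" "q \<in> carrier XY" "q' \<in> carrier XY" for s q q'
    using lift_add[OF abelian_group_tensor_group lact_balanced] that
    by (simp add: lact_tensor tensor_group_simps)
  show ra: "ract XY (q \<oplus>\<^bsub>XY\<^esub> q') u = ract XY q u \<oplus>\<^bsub>XY\<^esub> ract XY q' u"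
    if "u \<in> carrier U" "q \<in> carrier XY" "q' \<in> carrier XY" for u q q'
    using lift_add[OF abelian_group_tensor_group ract_balanced] that
    by (simp add: ract_tensor tensor_group_simps)
  show "lact XY s (ract XY q u) = ract XY (lact XY s q) u"
    if "s \<in> carrier S" "u \<in> carrier U" "q \<in> carrier XY" for s u q
    using that(3)
    by (induction q rule: tensor_induct)
      (simp_all add: that(1,2) l r la ra lact_pure ract_pure X.lact_closed Y.ract_closed)
qed

end

section \<open>Endomorphisms and the centralizer of an extension\<close>

locale ring_extension = N: ring N + M?: ring M
  for N :: "('n, 'k1) ring_scheme" and M :: "('m, 'k2) ring_scheme" (structure) +
  fixes h :: "'n \<Rightarrow> 'm"
  assumes hom: "h \<in> ring_hom N M"
begin

abbreviation "MN \<equiv> restrict_scalars id h (regular_bimod M)"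
abbreviation "NM \<equiv> restrict_scalars h id (regular_bimod M)"
abbreviation "MM \<equiv> extension_tensor N M h"
abbreviation "R \<equiv> centralizer_ring N M h"
abbreviation "A \<equiv> extension_End N M h"
abbreviation "B \<equiv> bialgebroid_bimod A (D2_source M) (D2_target M)"

lemma h_closed [simp]: "n \<in> carrier N \<Longrightarrow> h n \<in> carrier M"
  using hom by (rule ring_hom_closed)

lemma MN_simps [simp]:
  "carrier MN = carrier M" "add MN = add M" "zero MN = zero M"
  "lact MN m x = m \<otimes> x" "ract MN x n = x \<otimes> h n"
  and NM_simps [simp]:
  "carrier NM = carrier M" "add NM = add M" "zero NM = zero M"
  "lact NM n x = h n \<otimes> x" "ract NM x m = x \<otimes> m"
  by (simp_all add: restrict_scalars_def regular_bimod_def bimod_of_def)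

lemma bimodule_MN: "bimodule M N MN"
proof -
  interpret MN: abelian_group MN
    by (rule abelian_groupI) (auto simp: a_ac intro: bexI[of _ "\<ominus> x" for x] l_neg)
  show ?thesis by unfold_locales (auto simp: l_distr r_distr m_assoc)
qed

lemma bimodule_NM: "bimodule N M NM"
proof -
  interpret NM: abelian_group NM
    by (rule abelian_groupI) (auto simp: a_ac intro: bexI[of _ "\<ominus> x" for x] l_neg)
  show ?thesis by unfold_locales (auto simp: l_distr r_distr m_assoc)
qed

sublocale MM: tensor_product M N M MN NM
  rewrites "tensor N MN NM = MM"
  by (intro tensor_product.intro bimodule_MN bimodule_NM) (simp add: extension_tensor_def)

lemma carrier_R: "r \<in> carrier R \<longleftrightarrow> r \<in> carrier M \<and> (\<forall>n\<in>carrier N. h n \<otimes> r = r \<otimes> h n)"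
  and R_simps [simp]: "mult R = mult M" "one R = one M" "zero R = zero M" "add R = add M"
  by (auto simp: centralizer_ring_def)

lemma R_closed [simp]: "r \<in> carrier R \<Longrightarrow> r \<in> carrier M"
  by (simp add: carrier_R)

lemma R_comm: "\<lbrakk>r \<in> carrier R; n \<in> carrier N\<rbrakk> \<Longrightarrow> h n \<otimes> r = r \<otimes> h n"
  by (simp add: carrier_R)

lemma ring_R: "ring R"
proof -
  have m: "x \<otimes> y \<in> carrier R" if xy: "x \<in> carrier R" "y \<in> carrier R" for x y
  proof -
    have "h n \<otimes> (x \<otimes> y) = (x \<otimes> y) \<otimes> h n" if n: "n \<in> carrier N" for n
    proof -
      have "h n \<otimes> (x \<otimes> y) = x \<otimes> (h n \<otimes> y)"
        using xy n by (simp add: R_comm[OF xy(1) n] flip: m_assoc)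
      also have "\<dots> = (x \<otimes> y) \<otimes> h n" using xy n by (simp add: R_comm m_assoc)
      finally show ?thesis .
    qed
    then show ?thesis using xy by (simp add: carrier_R)
  qed
  have a: "x \<oplus> y \<in> carrier R" if "x \<in> carrier R" "y \<in> carrier R" for x y
    using that by (simp add: carrier_R l_distr r_distr)
  have i: "\<ominus> x \<in> carrier R" if "x \<in> carrier R" for x
    using that by (simp add: carrier_R l_minus r_minus)
  have z: "\<zero> \<in> carrier R" "\<one> \<in> carrier R" by (auto simp: carrier_R)
  show ?thesis
  proof (rule ringI)
    show "abelian_group R"
    proof (rule abelian_groupI)
      show "\<exists>y\<in>carrier R. y \<oplus>\<^bsub>R\<^esub> x = \<zero>\<^bsub>R\<^esub>" if "x \<in> carrier R" for x
        using that i l_neg by (intro bexI[of _ "\<ominus> x"]) simp_all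
    qed (simp_all add: a z a_ac)
    show "monoid R" by (rule monoidI) (simp_all add: m z m_assoc)
  qed (simp_all add: l_distr r_distr)
qed

sublocale R: ring R by (rule ring_R)

lemma A_iff: "f \<in> carrier A \<longleftrightarrow> f \<in> extensional (carrier M) \<and> (\<forall>x\<in>carrier M. f x \<in> carrier M) \<and>
    (\<forall>x\<in>carrier M. \<forall>y\<in>carrier M. f (x \<oplus> y) = f x \<oplus> f y) \<and>
    (\<forall>n\<in>carrier N. \<forall>x\<in>carrier M. f (h n \<otimes> x) = h n \<otimes> f x) \<and>
    (\<forall>n\<in>carrier N. \<forall>x\<in>carrier M. f (x \<otimes> h n) = f x \<otimes> h n)"
  by (auto simp: extension_End_def bimod_End_def map_ring_def bimod_hom_def restrict_scalars_def
      regular_bimod_def bimod_of_def Pi_def)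

lemma AI:
  assumes "f \<in> extensional (carrier M)" "\<And>x. x \<in> carrier M \<Longrightarrow> f x \<in> carrier M"
    and "\<And>x y. \<lbrakk>x \<in> carrier M; y \<in> carrier M\<rbrakk> \<Longrightarrow> f (x \<oplus> y) = f x \<oplus> f y"
    and "\<And>n x. \<lbrakk>n \<in> carrier N; x \<in> carrier M\<rbrakk> \<Longrightarrow> f (h n \<otimes> x) = h n \<otimes> f x"
    and "\<And>n x. \<lbrakk>n \<in> carrier N; x \<in> carrier M\<rbrakk> \<Longrightarrow> f (x \<otimes> h n) = f x \<otimes> h n"
  shows "f \<in> carrier A"
  using assms by (simp add: A_iff)

lemma A_closed [simp]: "\<lbrakk>f \<in> carrier A; x \<in> carrier M\<rbrakk> \<Longrightarrow> f x \<in> carrier M"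
  and A_add: "\<lbrakk>f \<in> carrier A; x \<in> carrier M; y \<in> carrier M\<rbrakk> \<Longrightarrow> f (x \<oplus> y) = f x \<oplus> f y"
  and A_left: "\<lbrakk>f \<in> carrier A; n \<in> carrier N; x \<in> carrier M\<rbrakk> \<Longrightarrow> f (h n \<otimes> x) = h n \<otimes> f x"
  and A_right: "\<lbrakk>f \<in> carrier A; n \<in> carrier N; x \<in> carrier M\<rbrakk> \<Longrightarrow> f (x \<otimes> h n) = f x \<otimes> h n"
  by (simp_all add: A_iff)

lemma A_ext:
  assumes "f \<in> carrier A" "g \<in> carrier A" "\<And>x. x \<in> carrier M \<Longrightarrow> f x = g x" shows "f = g"
  using assms by (intro extensionalityI[of f "carrier M" g]) (auto simp: A_iff)

lemma A_ops:
  "mult A f g = compose (carrier M) f g" "one A = (\<lambda>x\<in>carrier M. x)" "zero A = (\<lambda>x\<in>carrier M. \<zero>)"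
  "add A f g = (\<lambda>x\<in>carrier M. f x \<oplus> g x)"
  by (simp_all add: extension_End_def bimod_End_def map_ring_def restrict_scalars_def
      regular_bimod_def bimod_of_def)

lemma A_apply [simp]:
  assumes "x \<in> carrier M"
  shows "mult A f g x = f (g x)" "one A x = x" "zero A x = \<zero>" "add A f g x = f x \<oplus> g x"
  using assms by (simp_all add: A_ops compose_def)

lemma A_mult [simp]: "\<lbrakk>f \<in> carrier A; g \<in> carrier A\<rbrakk> \<Longrightarrow> mult A f g \<in> carrier A"
  by (rule AI) (auto simp: A_add A_left A_right, simp add: A_ops)

lemma A_plus [simp]: "\<lbrakk>f \<in> carrier A; g \<in> carrier A\<rbrakk> \<Longrightarrow> add A f g \<in> carrier A"
  by (rule AI) (auto simp: A_add A_left A_right l_distr r_distr a_ac, simp add: A_ops)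

lemma A_one [simp]: "one A \<in> carrier A"
  by (rule AI) (simp_all, simp add: A_ops)

lemma A_zero [simp]: "zero A \<in> carrier A"
  by (rule AI) (simp_all, simp add: A_ops)

lemma ring_A: "ring A"
proof (rule ringI)
  show "abelian_group A"
  proof (rule abelian_groupI)
    show "\<exists>y\<in>carrier A. y \<oplus>\<^bsub>A\<^esub> f = \<zero>\<^bsub>A\<^esub>" if f: "f \<in> carrier A" for f
    proof
      show g: "(\<lambda>x\<in>carrier M. \<ominus> f x) \<in> carrier A"
        using f by (intro AI) (auto simp: A_add A_left A_right minus_add l_minus r_minus a_ac)
      show "(\<lambda>x\<in>carrier M. \<ominus> f x) \<oplus>\<^bsub>A\<^esub> f = \<zero>\<^bsub>A\<^esub>"
        using f g by (intro A_ext) (auto simp: l_neg)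
    qed
  qed (simp_all, (rule A_ext; simp add: a_ac)+)
  show "monoid A"
    by (rule monoidI) (simp_all, (rule A_ext; simp)+)
  show "(f \<oplus>\<^bsub>A\<^esub> g) \<otimes>\<^bsub>A\<^esub> k = f \<otimes>\<^bsub>A\<^esub> k \<oplus>\<^bsub>A\<^esub> g \<otimes>\<^bsub>A\<^esub> k"
    "k \<otimes>\<^bsub>A\<^esub> (f \<oplus>\<^bsub>A\<^esub> g) = k \<otimes>\<^bsub>A\<^esub> f \<oplus>\<^bsub>A\<^esub> k \<otimes>\<^bsub>A\<^esub> g"
    if "f \<in> carrier A" "g \<in> carrier A" "k \<in> carrier A" for f g k
    using that by (auto intro!: A_ext simp: A_add)
qed

sublocale A: ring A by (rule ring_A)

lemma source_apply [simp]: "x \<in> carrier M \<Longrightarrow> D2_source M r x = r \<otimes> x"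
  and target_apply [simp]: "x \<in> carrier M \<Longrightarrow> D2_target M r x = x \<otimes> r"
  by (simp_all add: D2_source_def D2_target_def)

text \<open>Right \<open>N\<close>-linearity is associativity; left \<open>N\<close>-linearity is
  where \<open>r\<close> must commute with the image of \<open>N\<close>. For
  \<open>target_closed\<close> the sides are exchanged.\<close>

lemma source_closed [simp]: "r \<in> carrier R \<Longrightarrow> D2_source M r \<in> carrier A"
  by (rule AI) (auto simp: r_distr D2_source_def R_comm simp flip: m_assoc)

lemma target_closed [simp]: "r \<in> carrier R \<Longrightarrow> D2_target M r \<in> carrier A"
  by (rule AI) (auto simp: l_distr m_assoc D2_target_def R_comm)

lemma B_simps [simp]:
  "carrier B = carrier A" "add B = add A" "zero B = zero A"
  "lact B r a = D2_source M r \<otimes>\<^bsub>A\<^esub> a" "ract B a r = D2_target M r \<otimes>\<^bsub>A\<^esub> a"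
  by (simp_all add: bialgebroid_bimod_def bimod_of_def)

lemma bimodule_B: "bimodule R R B"
proof -
  interpret B: abelian_group B
    by (rule abelian_groupI) (auto simp: A.a_ac intro: bexI[of _ "\<ominus>\<^bsub>A\<^esub> x" for x] A.l_neg)
  show ?thesis
    by unfold_locales (auto intro!: A_ext simp: l_distr r_distr m_assoc)
qed

sublocale B: bimodule R R B by (rule bimodule_B)
sublocale BB: tensor_product R R R B B
  by (intro tensor_product.intro bimodule_B)

section \<open>Contraction of M \<otimes> M over N with left N-linear maps\<close>

definition left_linear :: "('m \<Rightarrow> 'm) \<Rightarrow> bool" where
  "left_linear f \<longleftrightarrow> (\<forall>x\<in>carrier M. f x \<in> carrier M) \<and>
    (\<forall>x\<in>carrier M. \<forall>y\<in>carrier M. f (x \<oplus> y) = f x \<oplus> f y) \<and>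
    (\<forall>n\<in>carrier N. \<forall>x\<in>carrier M. f (h n \<otimes> x) = h n \<otimes> f x)"

text \<open>For \<open>w = w\<^sup>1 \<otimes> w\<^sup>2\<close> this is
  \<open>w\<^sup>1 f(w\<^sup>2)\<close>; left \<open>N\<close>-linearity of \<open>f\<close> makes
  it independent of the representation of \<open>w\<close>.\<close>

definition contract :: "('m \<Rightarrow> 'm) \<Rightarrow> ('m \<times> 'm \<Rightarrow>\<^sub>0 int) set \<Rightarrow> 'm" where
  "contract f = tensor_lift M (\<lambda>x y. x \<otimes> f y)"

lemma left_linear_A: "f \<in> carrier A \<Longrightarrow> left_linear f"
  by (simp add: A_iff left_linear_def)

text \<open>The reason for working with \<open>left_linear\<close> instead of \<open>A\<close>: a
  shift by an arbitrary \<open>m\<close> keeps left \<open>N\<close>-linearity but in general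
  destroys right \<open>N\<close>-linearity.\<close>

lemma left_linear_shift:
  "\<lbrakk>left_linear f; m \<in> carrier M\<rbrakk> \<Longrightarrow> left_linear (\<lambda>y. f (y \<otimes> m))"
  by (simp add: left_linear_def l_distr m_assoc)

lemma left_linear_add: "\<lbrakk>left_linear f; left_linear g\<rbrakk> \<Longrightarrow> left_linear (\<lambda>y. f y \<oplus> g y)"
  by (simp add: left_linear_def r_distr a_ac)

lemma left_linear_mult: "\<lbrakk>left_linear f; m \<in> carrier M\<rbrakk> \<Longrightarrow> left_linear (\<lambda>y. f y \<otimes> m)"
  by (simp add: left_linear_def l_distr m_assoc)

lemma contract_balanced: "left_linear f \<Longrightarrow> balanced_map N MN NM M (\<lambda>x y. x \<otimes> f y)"
  by (rule balanced_mapI) (auto simp: left_linear_def l_distr r_distr m_assoc)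

lemma contract_hom: "left_linear f \<Longrightarrow> abelian_group_hom MM M (contract f)"
  unfolding contract_def by (intro MM.lift_hom contract_balanced abelian_group_axioms)

lemma contract_closed [simp]: "\<lbrakk>left_linear f; w \<in> carrier MM\<rbrakk> \<Longrightarrow> contract f w \<in> carrier M"
  by (rule abelian_group_hom.hom_closed[OF contract_hom])

lemma contract_plus:
  "\<lbrakk>left_linear f; w \<in> carrier MM; w' \<in> carrier MM\<rbrakk> \<Longrightarrow>
    contract f (w \<oplus>\<^bsub>MM\<^esub> w') = contract f w \<oplus> contract f w'"
  by (rule abelian_group_hom.hom_add[OF contract_hom])

lemma contract_pure:
  "\<lbrakk>left_linear f; x \<in> carrier M; y \<in> carrier M\<rbrakk> \<Longrightarrow> contract f (MM.pt x y) = x \<otimes> f y"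
  unfolding contract_def by (subst MM.lift_pure[OF abelian_group_axioms contract_balanced]) auto

lemma contract_cong:
  assumes "left_linear f" "w \<in> carrier MM" "\<And>x. x \<in> carrier M \<Longrightarrow> g x = f x"
  shows "contract g w = contract f w"
  unfolding contract_def
  by (rule MM.lift_cong[OF abelian_group_axioms contract_balanced]) (use assms in auto)

lemma contract_lact:
  assumes f: "left_linear f" and m: "m \<in> carrier M" and w: "w \<in> carrier MM"
  shows "contract f (lact MM m w) = m \<otimes> contract f w"
  using w
proof (induction w rule: MM.tensor_induct)
  case (pure x y)
  then show ?case using f m by (simp add: MM.lact_pure contract_pure m_assoc left_linear_def)
next
  case (add w w')
  then show ?case
    using f m by (simp add: MM.XY.lact_add MM.XY.lact_closed contract_plus r_distr)
qed

text \<open>The right action touches only the second leg and so becomes a shift of the argument of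
  \<open>f\<close>. With \<open>contract_lact\<close>, the condition \<open>n w = w n\<close> turns
  into a statement about functions.\<close>

lemma contract_ract:
  assumes f: "left_linear f" and m: "m \<in> carrier M" and w: "w \<in> carrier MM"
  shows "contract f (ract MM w m) = contract (\<lambda>y. f (y \<otimes> m)) w"
  using w
proof (induction w rule: MM.tensor_induct)
  case (pure x y)
  then show ?case using f m by (simp add: MM.ract_pure contract_pure left_linear_shift)
next
  case (add w w')
  then show ?case
    using f m left_linear_shift[OF f m] by (simp add: MM.XY.ract_add MM.XY.ract_closed contract_plus)
qed

lemma contract_add:
  assumes f: "left_linear f" and g: "left_linear g" and w: "w \<in> carrier MM"
  shows "contract (\<lambda>y. f y \<oplus> g y) w = contract f w \<oplus> contract g w"
  using w
proof (induction w rule: MM.tensor_induct)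
  case (pure x y)
  then show ?case
    using f g left_linear_add[OF f g] by (simp add: contract_pure r_distr left_linear_def)
next
  case (add w w')
  then show ?case
    using f g left_linear_add[OF f g] by (simp add: contract_plus a_ac)
qed

lemma contract_mult:
  assumes f: "left_linear f" and m: "m \<in> carrier M" and w: "w \<in> carrier MM"
  shows "contract (\<lambda>y. f y \<otimes> m) w = contract f w \<otimes> m"
  using w
proof (induction w rule: MM.tensor_induct)
  case (pure x y)
  then show ?case
    using f m left_linear_mult[OF f m] by (simp add: contract_pure m_assoc left_linear_def)
next
  case (add w w')
  then show ?case
    using f m left_linear_mult[OF f m] by (simp add: contract_plus l_distr)
qed

text \<open>\<open>n w\<^sup>1 f(w\<^sup>2) = w\<^sup>1 f(w\<^sup>2 n) = w\<^sup>1 f(w\<^sup>2)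
  n\<close>: the first equality moves \<open>n\<close> through the central tensor \<open>w\<close>,
  the second is right \<open>N\<close>-linearity of \<open>f\<close>.\<close>

lemma contract_centralizer:
  assumes f: "f \<in> carrier A" and w: "w \<in> tensor_centralizer N M h"
  shows "contract f w \<in> carrier R"
proof -
  have w': "w \<in> carrier MM" "\<And>n. n \<in> carrier N \<Longrightarrow> lact MM (h n) w = ract MM w (h n)"
    using w by (auto simp: tensor_centralizer_def)
  note l = left_linear_A[OF f]
  have "h n \<otimes> contract f w = contract f w \<otimes> h n" if n: "n \<in> carrier N" for n
  proof -
    have "h n \<otimes> contract f w = contract (\<lambda>y. f (y \<otimes> h n)) w"
      using w' n contract_lact[OF l _ w'(1)] contract_ract[OF l _ w'(1)] by (metis h_closed)
    also have "\<dots> = contract (\<lambda>y. f y \<otimes> h n) w"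
      by (rule contract_cong) (use n l w' f in \<open>auto simp: left_linear_mult A_right\<close>)
    finally show ?thesis using contract_mult[OF l _ w'(1)] n by simp
  qed
  then show ?thesis using l w' by (simp add: carrier_R)
qed

text \<open>The map \<open>w\<^sup>1 f(w\<^sup>2 -)\<close>. With \<open>w = c i\<close> it is the
  second tensor factor of the comultiplication of \<open>f\<close>.\<close>

definition right_leg :: "('m \<Rightarrow> 'm) \<Rightarrow> ('m \<times> 'm \<Rightarrow>\<^sub>0 int) set \<Rightarrow> 'm \<Rightarrow> 'm" where
  "right_leg f w = (\<lambda>m\<in>carrier M. contract (\<lambda>y. f (y \<otimes> m)) w)"

text \<open>Additivity and right \<open>N\<close>-linearity are inherited from \<open>f\<close>.
  Left \<open>N\<close>-linearity comes from \<open>w\<close>: an \<open>n\<close> in front of the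
  argument is absorbed by the second leg as \<open>w n\<close>, and \<open>w n = n w\<close> brings
  it out on the left.\<close>

lemma right_leg_closed [simp]:
  assumes f: "f \<in> carrier A" and w: "w \<in> tensor_centralizer N M h"
  shows "right_leg f w \<in> carrier A"
proof (rule AI)
  have w': "w \<in> carrier MM" "\<And>n. n \<in> carrier N \<Longrightarrow> lact MM (h n) w = ract MM w (h n)"
    using w by (auto simp: tensor_centralizer_def)
  note l = left_linear_shift[OF left_linear_A[OF f]]
  show "right_leg f w \<in> extensional (carrier M)" by (simp add: right_leg_def)
  show "right_leg f w m \<in> carrier M" if "m \<in> carrier M" for m
    using that l w' by (simp add: right_leg_def)
  show "right_leg f w (x \<oplus> y) = right_leg f w x \<oplus> right_leg f w y"
    if xy: "x \<in> carrier M" "y \<in> carrier M" for x y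
  proof -
    have "contract (\<lambda>z. f (z \<otimes> (x \<oplus> y))) w = contract (\<lambda>z. f (z \<otimes> x) \<oplus> f (z \<otimes> y)) w"
      by (rule contract_cong) (use xy l w' f in \<open>auto simp: left_linear_add r_distr A_add\<close>)
    then show ?thesis using xy l w' by (simp add: right_leg_def contract_add)
  qed
  show "right_leg f w (h n \<otimes> m) = h n \<otimes> right_leg f w m"
    if nm: "n \<in> carrier N" "m \<in> carrier M" for n m
  proof -
    have "contract (\<lambda>z. f (z \<otimes> (h n \<otimes> m))) w = contract (\<lambda>z. f (z \<otimes> h n \<otimes> m)) w"
      by (rule contract_cong) (use nm l[of m] left_linear_shift[OF l[of m], of "h n"] w' in \<open>auto simp: m_assoc\<close>)
    also have "\<dots> = contract (\<lambda>z. f (z \<otimes> m)) (ract MM w (h n))"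
      using contract_ract[OF l[of m], of "h n" w] nm w' by simp
    also have "\<dots> = h n \<otimes> contract (\<lambda>z. f (z \<otimes> m)) w"
      using contract_lact[OF l[of m], of "h n" w] nm w' by simp
    finally show ?thesis using nm by (simp add: right_leg_def)
  qed
  show "right_leg f w (m \<otimes> h n) = right_leg f w m \<otimes> h n"
    if nm: "n \<in> carrier N" "m \<in> carrier M" for n m
  proof -
    have "contract (\<lambda>z. f (z \<otimes> (m \<otimes> h n))) w = contract (\<lambda>z. f (z \<otimes> m) \<otimes> h n) w"
      by (rule contract_cong) (use nm l[of m] w' f in \<open>auto simp: left_linear_mult A_right simp flip: m_assoc\<close>)
    then show ?thesis using nm l[of m] w' contract_mult by (simp add: right_leg_def)
  qed
qed

end

section \<open>Quasibasis expansions and the separation of tensors by their values\<close>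

locale right_D2_extension = ring_extension N M h
  for N :: "('n, 'k1) ring_scheme" and M :: "('m, 'k2) ring_scheme" (structure) and h :: "'n \<Rightarrow> 'm" +
  fixes I :: "'i set" and c :: "'i \<Rightarrow> ('m \<times> 'm \<Rightarrow>\<^sub>0 int) set" and \<gamma> :: "'i \<Rightarrow> 'm \<Rightarrow> 'm"
  assumes quasibasis: "right_D2_quasibasis N M h I c \<gamma>"
begin

lemma c_centralizer [simp]: "i \<in> I \<Longrightarrow> c i \<in> tensor_centralizer N M h"
  and c_closed [simp]: "i \<in> I \<Longrightarrow> c i \<in> carrier MM"
  and \<gamma>_closed [simp]: "i \<in> I \<Longrightarrow> \<gamma> i \<in> carrier A"
  and quasibasis_sum: "m \<in> carrier M \<Longrightarrow> (\<Oplus>\<^bsub>MM\<^esub>i\<in>I. lact MM (\<gamma> i m) (c i)) = MM.pt \<one> m"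
  using quasibasis by (auto simp: right_D2_quasibasis_def Pi_def tensor_centralizer_def)

text \<open>Contract both sides of the quasibasis identity with \<open>f\<close>: the right-hand
  side \<open>1 \<otimes> m\<close> gives \<open>f m\<close>, and the coefficients
  \<open>\<gamma> i m\<close> come out on the left.\<close>

lemma quasibasis_expansion:
  assumes f: "left_linear f" and m: "m \<in> carrier M"
  shows "(\<Oplus>i\<in>I. \<gamma> i m \<otimes> contract f (c i)) = f m"
proof -
  interpret f: abelian_group_hom MM M "contract f" by (rule contract_hom[OF f])
  have "f m = contract f (\<Oplus>\<^bsub>MM\<^esub>i\<in>I. lact MM (\<gamma> i m) (c i))"
    using f m by (simp add: quasibasis_sum contract_pure left_linear_def)
  also have "\<dots> = (\<Oplus>i\<in>I. contract f (lact MM (\<gamma> i m) (c i)))"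
    by (rule f.hom_finsum) (use m in \<open>auto intro!: MM.XY.lact_closed\<close>)
  also have "\<dots> = (\<Oplus>i\<in>I. \<gamma> i m \<otimes> contract f (c i))"
    by (rule finsum_cong') (use m f in \<open>auto simp: contract_lact\<close>)
  finally show ?thesis by simp
qed

text \<open>A left \<open>R\<close>-linear embedding of \<open>Y\<close> into the functions from
  \<open>K\<close> to \<open>M\<close>; the last clause is injectivity. It is stated for an abstract
  \<open>Y\<close> so that it can be propagated from \<open>Y\<close> to the tensor product of
  \<open>A\<close> with \<open>Y\<close> and then iterated.\<close>

definition separated ::
  "('u, 'k3) ring_scheme \<Rightarrow> ('m, 'u, 'y) bimodule \<Rightarrow> 'z set \<Rightarrow> ('y \<Rightarrow> 'z \<Rightarrow> 'm) \<Rightarrow> bool" where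
  "separated U Y K ev \<longleftrightarrow> bimodule R U Y \<and>
    (\<forall>y\<in>carrier Y. \<forall>k\<in>K. ev y k \<in> carrier M) \<and>
    (\<forall>y\<in>carrier Y. \<forall>y'\<in>carrier Y. \<forall>k\<in>K. ev (y \<oplus>\<^bsub>Y\<^esub> y') k = ev y k \<oplus> ev y' k) \<and>
    (\<forall>r\<in>carrier R. \<forall>y\<in>carrier Y. \<forall>k\<in>K. ev (lact Y r y) k = r \<otimes> ev y k) \<and>
    (\<forall>y\<in>carrier Y. (\<forall>k\<in>K. ev y k = \<zero>) \<longrightarrow> y = \<zero>\<^bsub>Y\<^esub>)"

definition tensor_eval :: "('y \<Rightarrow> 'z \<Rightarrow> 'm) \<Rightarrow> (('m \<Rightarrow> 'm) \<times> 'y \<Rightarrow>\<^sub>0 int) set \<Rightarrow> 'm \<times> 'z \<Rightarrow> 'm" where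
  "tensor_eval ev q z = tensor_lift M (\<lambda>a y. a (fst z) \<otimes> ev y (snd z)) q"

context
  fixes U :: "('u, 'k3) ring_scheme" and Y :: "('m, 'u, 'y) bimodule" and K :: "'z set" and ev
  assumes sep: "separated U Y K ev"
begin

interpretation Y: bimodule R U Y using sep by (simp add: separated_def)

lemma separated_bimodule: "bimodule R U Y" ..

lemma ev_closed: "\<lbrakk>y \<in> carrier Y; k \<in> K\<rbrakk> \<Longrightarrow> ev y k \<in> carrier M"
  and ev_add: "\<lbrakk>y \<in> carrier Y; y' \<in> carrier Y; k \<in> K\<rbrakk> \<Longrightarrow> ev (y \<oplus>\<^bsub>Y\<^esub> y') k = ev y k \<oplus> ev y' k"
  and ev_lact: "\<lbrakk>r \<in> carrier R; y \<in> carrier Y; k \<in> K\<rbrakk> \<Longrightarrow> ev (lact Y r y) k = r \<otimes> ev y k"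
  and ev_zero: "\<lbrakk>y \<in> carrier Y; \<And>k. k \<in> K \<Longrightarrow> ev y k = \<zero>\<rbrakk> \<Longrightarrow> y = \<zero>\<^bsub>Y\<^esub>"
  using sep by (auto simp: separated_def)

lemma ev_hom: "k \<in> K \<Longrightarrow> abelian_group_hom Y M (\<lambda>y. ev y k)"
  by (intro abelian_group_homI_additive Y.abelian_group_axioms abelian_group_axioms) (auto simp: ev_closed ev_add)

lemma separated_eqI:
  assumes "y \<in> carrier Y" "y' \<in> carrier Y" "\<And>k. k \<in> K \<Longrightarrow> ev y k = ev y' k"
  shows "y = y'"
proof (rule Y.eq_if_minus_zero[OF assms(1,2)], rule ev_zero)
  show "ev (y \<ominus>\<^bsub>Y\<^esub> y') k = \<zero>" if k: "k \<in> K" for k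
  proof -
    interpret ek: abelian_group_hom Y M "\<lambda>y. ev y k" by (rule ev_hom[OF k])
    show ?thesis using assms k by (simp add: a_minus_def ev_add ek.hom_a_inv ev_closed r_neg)
  qed
qed (use assms in auto)

interpretation BY: tensor_product R R U B Y
  by (intro tensor_product.intro bimodule_B separated_bimodule)

lemma tensor_eval_balanced:
  "\<lbrakk>m \<in> carrier M; k \<in> K\<rbrakk> \<Longrightarrow> balanced_map R B Y M (\<lambda>a y. a m \<otimes> ev y k)"
  by (rule balanced_mapI) (auto simp: ev_closed ev_add ev_lact l_distr r_distr m_assoc)

lemma tensor_eval_hom:
  "\<lbrakk>m \<in> carrier M; k \<in> K\<rbrakk> \<Longrightarrow> abelian_group_hom BY.XY M (\<lambda>q. tensor_eval ev q (m, k))"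
  unfolding tensor_eval_def by (simp add: BY.lift_hom[OF abelian_group_axioms tensor_eval_balanced])

lemma tensor_eval_closed:
  "\<lbrakk>q \<in> carrier BY.XY; m \<in> carrier M; k \<in> K\<rbrakk> \<Longrightarrow> tensor_eval ev q (m, k) \<in> carrier M"
  using abelian_group_hom.hom_closed[OF tensor_eval_hom] .

lemma tensor_eval_add:
  "\<lbrakk>q \<in> carrier BY.XY; q' \<in> carrier BY.XY; m \<in> carrier M; k \<in> K\<rbrakk> \<Longrightarrow>
    tensor_eval ev (q \<oplus>\<^bsub>BY.XY\<^esub> q') (m, k) = tensor_eval ev q (m, k) \<oplus> tensor_eval ev q' (m, k)"
  using abelian_group_hom.hom_add[OF tensor_eval_hom] .

lemma tensor_eval_pure:
  "\<lbrakk>a \<in> carrier A; y \<in> carrier Y; m \<in> carrier M; k \<in> K\<rbrakk> \<Longrightarrow>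
    tensor_eval ev (BY.pt a y) (m, k) = a m \<otimes> ev y k"
  by (simp add: tensor_eval_def BY.lift_pure[OF abelian_group_axioms tensor_eval_balanced])

lemma tensor_eval_lact:
  assumes r: "r \<in> carrier R" and q: "q \<in> carrier BY.XY" and mk: "m \<in> carrier M" "k \<in> K"
  shows "tensor_eval ev (lact BY.XY r q) (m, k) = r \<otimes> tensor_eval ev q (m, k)"
  using q
proof (induction q rule: BY.tensor_induct)
  case (pure a y)
  then show ?case using r mk by (simp add: BY.lact_pure tensor_eval_pure m_assoc ev_closed)
next
  case (add q q')
  then show ?case
    using r mk by (simp add: BY.XY.lact_add BY.XY.lact_closed tensor_eval_add r_distr tensor_eval_closed)
qed

text \<open>By separation it suffices to compare values, where this is distributivity in
  \<open>M\<close>. Together with \<open>lact_mult_scalar\<close> it makes \<open>coeff\<close>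
  additive and balanced in its first factor.\<close>

lemma lact_add_scalar:
  "\<lbrakk>r \<in> carrier R; r' \<in> carrier R; y \<in> carrier Y\<rbrakk> \<Longrightarrow> lact Y (r \<oplus> r') y = lact Y r y \<oplus>\<^bsub>Y\<^esub> lact Y r' y"
  using R.a_closed[of r r']
  by (intro separated_eqI) (auto simp: ev_lact ev_add l_distr Y.lact_closed ev_closed)

lemma lact_mult_scalar:
  "\<lbrakk>r \<in> carrier R; r' \<in> carrier R; y \<in> carrier Y\<rbrakk> \<Longrightarrow> lact Y (r \<otimes> r') y = lact Y r (lact Y r' y)"
  using R.m_closed[of r r']
  by (intro separated_eqI) (auto simp: ev_lact m_assoc Y.lact_closed ev_closed)

text \<open>Stands for \<open>c\<^sub>i\<^sup>1 q(c\<^sub>i\<^sup>2, -)\<close>. Lifting \<open>a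
  \<otimes> y \<mapsto> (c\<^sub>i\<^sup>1 a(c\<^sub>i\<^sup>2)) \<cdot> y\<close> yields an element
  of \<open>Y\<close> rather than a mere function on \<open>K\<close>; this is possible because the
  scalar lies in \<open>R\<close>.\<close>

definition coeff :: "'i \<Rightarrow> (('m \<Rightarrow> 'm) \<times> 'y \<Rightarrow>\<^sub>0 int) set \<Rightarrow> 'y" where
  "coeff i = tensor_lift Y (\<lambda>a y. lact Y (contract a (c i)) y)"

lemma coeff_balanced:
  assumes i: "i \<in> I" shows "balanced_map R B Y Y (\<lambda>a y. lact Y (contract a (c i)) y)"
proof (rule balanced_mapI)
  note cl = contract_centralizer[OF _ c_centralizer[OF i]]
  show "lact Y (contract a (c i)) y \<in> carrier Y" if "a \<in> carrier B" "y \<in> carrier Y" for a y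
    using that cl by (simp add: Y.lact_closed)
  show "lact Y (contract (a \<oplus>\<^bsub>B\<^esub> a') (c i)) y = lact Y (contract a (c i)) y \<oplus>\<^bsub>Y\<^esub> lact Y (contract a' (c i)) y"
    if "a \<in> carrier B" "a' \<in> carrier B" "y \<in> carrier Y" for a a' y
  proof -
    have "contract (a \<oplus>\<^bsub>A\<^esub> a') (c i) = contract (\<lambda>y. a y \<oplus> a' y) (c i)"
      by (rule contract_cong) (use that i in \<open>auto simp: left_linear_add left_linear_A\<close>)
    then show ?thesis using that i cl by (simp add: contract_add left_linear_A lact_add_scalar)
  qed
  show "lact Y (contract a (c i)) (y \<oplus>\<^bsub>Y\<^esub> y') = lact Y (contract a (c i)) y \<oplus>\<^bsub>Y\<^esub> lact Y (contract a (c i)) y'"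
    if "a \<in> carrier B" "y \<in> carrier Y" "y' \<in> carrier Y" for a y y'
    using that cl by (simp add: Y.lact_add)
  show "lact Y (contract (ract B a r) (c i)) y = lact Y (contract a (c i)) (lact Y r y)"
    if "a \<in> carrier B" "r \<in> carrier R" "y \<in> carrier Y" for a r y
  proof -
    have "contract (ract B a r) (c i) = contract (\<lambda>y. a y \<otimes> r) (c i)"
      by (rule contract_cong) (use that i in \<open>auto simp: left_linear_mult left_linear_A\<close>)
    then show ?thesis using that i cl by (simp add: contract_mult left_linear_A lact_mult_scalar)
  qed
qed

lemma coeff_hom: "i \<in> I \<Longrightarrow> abelian_group_hom BY.XY Y (coeff i)"
  unfolding coeff_def by (intro BY.lift_hom coeff_balanced Y.abelian_group_axioms)

lemma coeff_pure: "\<lbrakk>i \<in> I; a \<in> carrier A; y \<in> carrier Y\<rbrakk> \<Longrightarrow> coeff i (BY.pt a y) = lact Y (contract a (c i)) y"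
  unfolding coeff_def by (subst BY.lift_pure[OF Y.abelian_group_axioms coeff_balanced]) auto

text \<open>On \<open>a \<otimes> y\<close> the scalar
  \<open>r\<^sub>i = c\<^sub>i\<^sup>1 a(c\<^sub>i\<^sup>2)\<close> moves across the tensor sign,
  leaving \<open>(\<Sum>\<^sub>i \<gamma>\<^sub>i \<cdot> r\<^sub>i) \<otimes> y\<close>, and by
  \<open>quasibasis_expansion\<close> the left factor is \<open>a\<close>. The general case is
  additivity.\<close>

lemma coeff_expansion:
  assumes q: "q \<in> carrier BY.XY"
  shows "(\<Oplus>\<^bsub>BY.XY\<^esub>i\<in>I. BY.pt (\<gamma> i) (coeff i q)) = q"
proof -
  have cl: "coeff i q \<in> carrier Y" if "i \<in> I" "q \<in> carrier BY.XY" for i q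
    by (rule abelian_group_hom.hom_closed[OF coeff_hom[OF that(1)] that(2)])
  show ?thesis using q
  proof (induction q rule: BY.tensor_induct)
    case (pure a y)
    then have a: "a \<in> carrier A" and y: "y \<in> carrier Y" by auto
    note cR = contract_centralizer[OF a c_centralizer]
    interpret l: abelian_group_hom B BY.XY "\<lambda>x. BY.pt x y" by (rule BY.pure_left_hom) fact
    have "(\<Oplus>\<^bsub>BY.XY\<^esub>i\<in>I. BY.pt (\<gamma> i) (coeff i (BY.pt a y))) =
        (\<Oplus>\<^bsub>BY.XY\<^esub>i\<in>I. BY.pt (ract B (\<gamma> i) (contract a (c i))) y)"
      by (rule BY.XY.finsum_cong')
        (use a y cR in \<open>auto simp: coeff_pure BY.pure_balanced[symmetric] simp del: B_simps(5) intro!: BY.pure_closed B.ract_closed\<close>)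
    also have "\<dots> = BY.pt (\<Oplus>\<^bsub>B\<^esub>i\<in>I. ract B (\<gamma> i) (contract a (c i))) y"
      by (rule l.hom_finsum[symmetric]) (use cR in auto)
    also have "(\<Oplus>\<^bsub>B\<^esub>i\<in>I. ract B (\<gamma> i) (contract a (c i))) = a"
    proof (rule A_ext)
      show cl: "(\<Oplus>\<^bsub>B\<^esub>i\<in>I. ract B (\<gamma> i) (contract a (c i))) \<in> carrier A"
        using cR B.finsum_closed[of "\<lambda>i. ract B (\<gamma> i) (contract a (c i))" I] by auto
      show "a \<in> carrier A" by fact
      show "(\<Oplus>\<^bsub>B\<^esub>i\<in>I. ract B (\<gamma> i) (contract a (c i))) m = a m" if m: "m \<in> carrier M" for m
      proof -
        interpret e: abelian_group_hom B M "\<lambda>a. a m"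
          by (intro abelian_group_homI_additive B.abelian_group_axioms abelian_group_axioms) (use m in auto)
        have "(\<Oplus>\<^bsub>B\<^esub>i\<in>I. ract B (\<gamma> i) (contract a (c i))) m = (\<Oplus>i\<in>I. ract B (\<gamma> i) (contract a (c i)) m)"
          by (rule e.hom_finsum) (use cR in auto)
        also have "\<dots> = (\<Oplus>i\<in>I. \<gamma> i m \<otimes> contract a (c i))"
          by (rule finsum_cong') (use m cR in auto)
        also have "\<dots> = a m" by (rule quasibasis_expansion[OF left_linear_A[OF a] m])
        finally show ?thesis .
      qed
    qed
    finally show ?case .
  next
    case (add q q')
    have "(\<Oplus>\<^bsub>BY.XY\<^esub>i\<in>I. BY.pt (\<gamma> i) (coeff i (q \<oplus>\<^bsub>BY.XY\<^esub> q'))) =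
      (\<Oplus>\<^bsub>BY.XY\<^esub>i\<in>I. BY.pt (\<gamma> i) (coeff i q) \<oplus>\<^bsub>BY.XY\<^esub> BY.pt (\<gamma> i) (coeff i q'))"
      by (rule BY.XY.finsum_cong')
        (use add.hyps in \<open>auto simp: abelian_group_hom.hom_add[OF coeff_hom] BY.pure_add_right cl BY.pure_closed\<close>)
    also have "\<dots> = (\<Oplus>\<^bsub>BY.XY\<^esub>i\<in>I. BY.pt (\<gamma> i) (coeff i q)) \<oplus>\<^bsub>BY.XY\<^esub> (\<Oplus>\<^bsub>BY.XY\<^esub>i\<in>I. BY.pt (\<gamma> i) (coeff i q'))"
      by (rule BY.XY.finsum_addf) (use add.hyps in \<open>auto simp: cl BY.pure_closed\<close>)
    finally show ?case by (simp add: add.IH)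
  qed
qed

lemma left_linear_tensor_eval:
  assumes q: "q \<in> carrier BY.XY" and k: "k \<in> K"
  shows "left_linear (\<lambda>m. tensor_eval ev q (m, k))"
  using q
proof (induction q rule: BY.tensor_induct)
  case (pure a y)
  then show ?case
    using k by (simp add: left_linear_def tensor_eval_pure ev_closed A_add A_left l_distr m_assoc)
next
  case (add q q')
  then show ?case
    using k by (simp add: left_linear_def tensor_eval_add tensor_eval_closed r_distr a_ac)
qed

text \<open>The right-hand side mentions \<open>q\<close> only through its values, so the values of
  a tensor determine its coefficients.\<close>

lemma ev_coeff:
  assumes i: "i \<in> I" and q: "q \<in> carrier BY.XY" and k: "k \<in> K"
  shows "ev (coeff i q) k = contract (\<lambda>m. tensor_eval ev q (m, k)) (c i)"
  using q
proof (induction q rule: BY.tensor_induct)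
  case (pure a y)
  then have a: "left_linear a" and y: "ev y k \<in> carrier M"
    using k by (simp_all add: left_linear_A ev_closed)
  have "contract (\<lambda>m. tensor_eval ev (BY.pt a y) (m, k)) (c i) = contract (\<lambda>m. a m \<otimes> ev y k) (c i)"
    by (rule contract_cong) (use pure i k a y in \<open>auto simp: left_linear_mult tensor_eval_pure\<close>)
  also have "\<dots> = ev (coeff i (BY.pt a y)) k"
    using pure i k a y by (simp add: contract_mult coeff_pure ev_lact contract_centralizer)
  finally show ?case by simp
next
  case (add q q')
  interpret ci: abelian_group_hom BY.XY Y "coeff i" by (rule coeff_hom[OF i])
  have "contract (\<lambda>m. tensor_eval ev (q \<oplus>\<^bsub>BY.XY\<^esub> q') (m, k)) (c i) =
      contract (\<lambda>m. tensor_eval ev q (m, k) \<oplus> tensor_eval ev q' (m, k)) (c i)"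
    by (rule contract_cong)
      (use add i k in \<open>auto intro!: left_linear_add left_linear_tensor_eval simp: tensor_eval_add\<close>)
  also have "\<dots> = ev (coeff i (q \<oplus>\<^bsub>BY.XY\<^esub> q')) k"
    using add i k by (simp add: contract_add left_linear_tensor_eval ev_add)
  finally show ?case by simp
qed

text \<open>If all values of \<open>q\<close> vanish, so do those of each \<open>coeff i q\<close>
  by \<open>ev_coeff\<close>; separation of \<open>Y\<close> makes the coefficients zero, and
  \<open>coeff_expansion\<close> rebuilds \<open>q\<close> as zero.\<close>

theorem separated_tensor: "separated U BY.XY (carrier M \<times> K) (tensor_eval ev)"
  unfolding separated_def
proof (intro conjI ballI impI BY.XY.bimodule_axioms)
  show "q = \<zero>\<^bsub>BY.XY\<^esub>" if q: "q \<in> carrier BY.XY"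
    and z: "\<forall>k\<in>carrier M \<times> K. tensor_eval ev q k = \<zero>" for q
  proof -
    have "coeff i q = \<zero>\<^bsub>Y\<^esub>" if i: "i \<in> I" for i
    proof (rule ev_zero)
      show "coeff i q \<in> carrier Y" by (rule abelian_group_hom.hom_closed[OF coeff_hom[OF i] q])
      have zl: "left_linear (\<lambda>m. \<zero>)" by (simp add: left_linear_def)
      show "ev (coeff i q) k = \<zero>" if k: "k \<in> K" for k
      proof -
        have "ev (coeff i q) k = contract (\<lambda>m. \<zero>) (c i)"
          unfolding ev_coeff[OF i q k] by (rule contract_cong[OF zl]) (use z k i in auto)
        also have "contract (\<lambda>m. \<zero>) w = \<zero>" if "w \<in> carrier MM" for w
          using that by (induction w rule: MM.tensor_induct) (simp_all add: contract_pure contract_plus zl)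
        finally show ?thesis using i by simp
      qed
    qed
    then have "(\<Oplus>\<^bsub>BY.XY\<^esub>i\<in>I. BY.pt (\<gamma> i) (coeff i q)) = (\<Oplus>\<^bsub>BY.XY\<^esub>i\<in>I. \<zero>\<^bsub>BY.XY\<^esub>)"
      by (intro BY.XY.finsum_cong') (auto simp: abelian_group_hom.hom_zero[OF BY.pure_right_hom])
    then show ?thesis by (simp add: BY.XY.finsum_zero coeff_expansion[OF q])
  qed
qed (auto simp: tensor_eval_closed tensor_eval_add tensor_eval_lact)

end

section \<open>The bialgebroid\<close>

abbreviation "\<Delta> \<equiv> D2_comult N M h I c \<gamma>"
abbreviation "eval2 \<equiv> tensor_eval (\<lambda>a :: 'm \<Rightarrow> 'm. a)"
abbreviation "eval3 \<equiv> tensor_eval eval2"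

text \<open>Evaluation on triples is set up for the bracketing A \<otimes> (A \<otimes> A). Elements
  of the other bracketing, \<open>BBl\<close>, are compared after \<open>tensor_assoc\<close> has
  carried them here.\<close>

sublocale BBr: tensor_product R R R B BB.XY
  by (intro tensor_product.intro bimodule_B BB.XY.bimodule_axioms)

sublocale BBl: tensor_product R R R BB.XY B
  by (intro tensor_product.intro bimodule_B BB.XY.bimodule_axioms)

lemmas R_ops [simp] = R.m_closed[simplified] R.a_closed[simplified] R.one_closed[simplified]

lemmas pure_add = BB.pure_add_left[simplified] BB.pure_add_right[simplified]
  BBr.pure_add_left[simplified] BBr.pure_add_right[simplified]
  BBl.pure_add_left[simplified] BBl.pure_add_right[simplified]

lemmas pure_balanced = BB.pure_balanced[simplified] BBl.pure_balanced[simplified]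

lemmas pure_closed = BB.pure_closed[simplified] BBr.pure_closed[simplified] BBl.pure_closed[simplified]

lemma separated1: "separated R B (carrier M) (\<lambda>a. a)"
  unfolding separated_def
  by (intro conjI bimodule_B ballI impI A_ext) (simp_all add: m_assoc)

lemma separated2: "separated R BB.XY (carrier M \<times> carrier M) eval2"
  by (rule separated_tensor[OF separated1])

lemma separated3: "separated R BBr.XY (carrier M \<times> carrier M \<times> carrier M) eval3"
  by (rule separated_tensor[OF separated2])

lemma tensor2_eqI:
  assumes "p \<in> carrier BB.XY" "q \<in> carrier BB.XY"
    and "\<And>m m'. \<lbrakk>m \<in> carrier M; m' \<in> carrier M\<rbrakk> \<Longrightarrow> eval2 p (m, m') = eval2 q (m, m')"
  shows "p = q"
  using separated_eqI[OF separated2 assms(1,2)] assms(3) by auto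

lemma tensor3_eqI:
  assumes "p \<in> carrier BBr.XY" "q \<in> carrier BBr.XY"
    and "\<And>m m' m''. \<lbrakk>m \<in> carrier M; m' \<in> carrier M; m'' \<in> carrier M\<rbrakk> \<Longrightarrow>
      eval3 p (m, m', m'') = eval3 q (m, m', m'')"
  shows "p = q"
  using separated_eqI[OF separated3 assms(1,2)] assms(3) by auto

lemmas eval2_closed [simp] = tensor_eval_closed[OF separated1]
lemmas eval2_add [simp] = tensor_eval_add[OF separated1]
lemmas eval2_pure = tensor_eval_pure[OF separated1]
lemmas eval2_lact = tensor_eval_lact[OF separated1]

lemma eval3_closed [simp]:
  "\<lbrakk>q \<in> carrier BBr.XY; m \<in> carrier M; m' \<in> carrier M; m'' \<in> carrier M\<rbrakk> \<Longrightarrow> eval3 q (m, m', m'') \<in> carrier M"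
  by (rule tensor_eval_closed[OF separated2]) auto

lemma eval3_add [simp]:
  "\<lbrakk>q \<in> carrier BBr.XY; q' \<in> carrier BBr.XY; m \<in> carrier M; m' \<in> carrier M; m'' \<in> carrier M\<rbrakk> \<Longrightarrow>
    eval3 (q \<oplus>\<^bsub>BBr.XY\<^esub> q') (m, m', m'') = eval3 q (m, m', m'') \<oplus> eval3 q' (m, m', m'')"
  by (rule tensor_eval_add[OF separated2]) auto

lemma eval3_pure:
  "\<lbrakk>a \<in> carrier A; q \<in> carrier BB.XY; m \<in> carrier M; m' \<in> carrier M; m'' \<in> carrier M\<rbrakk> \<Longrightarrow>
    eval3 (BBr.pt a q) (m, m', m'') = a m \<otimes> eval2 q (m', m'')"
  by (rule tensor_eval_pure[OF separated2]) auto

lemma eval2_ract: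
  assumes r: "r \<in> carrier R" and q: "q \<in> carrier BB.XY" and m: "m \<in> carrier M" "m' \<in> carrier M"
  shows "eval2 (ract BB.XY q r) (m, m') = eval2 q (m, m') \<otimes> r"
  using q
proof (induction q rule: BB.tensor_induct)
  case (pure a b)
  then show ?case using r m by (simp add: BB.ract_pure eval2_pure m_assoc)
next
  case (add q q')
  then show ?case using r m by (simp add: BB.XY.ract_add BB.XY.ract_closed l_distr)
qed

text \<open>\<open>D2_comult\<close> is stated over the pointwise bimodule \<open>D2_bimod\<close>,
  the bialgebroid axioms over \<open>B\<close>, whose actions multiply by source and target. The
  actions are shown to agree on the carriers; since relators range over carriers only, both give
  literally the same tensor group.\<close>

lemma lact_D2_bimod: "\<lbrakk>r \<in> carrier R; a \<in> carrier A\<rbrakk> \<Longrightarrow> lact (D2_bimod N M h) r a = lact B r a"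
  by (simp add: D2_bimod_def bimod_of_def A_ops compose_def D2_source_def)
    (simp add: restrict_def fun_eq_iff)

lemma ract_D2_bimod: "\<lbrakk>r \<in> carrier R; a \<in> carrier A\<rbrakk> \<Longrightarrow> ract (D2_bimod N M h) a r = ract B a r"
  by (simp add: D2_bimod_def bimod_of_def A_ops compose_def D2_target_def)
    (simp add: restrict_def fun_eq_iff)

lemma D2_bimod_simps:
  "carrier (D2_bimod N M h) = carrier B" "add (D2_bimod N M h) = add B"
  by (simp_all add: D2_bimod_def bimod_of_def)

lemma relators_D2_bimod:
  "tensor_relators R (D2_bimod N M h) (D2_bimod N M h) = tensor_relators R B B"
  unfolding tensor_relators_def D2_bimod_simps
  by (intro arg_cong2[where f = "(\<union>)"] refl Collect_cong)
    (metis lact_D2_bimod ract_D2_bimod B_simps(1))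

lemma pure_D2_bimod: "pure_tensor R (D2_bimod N M h) (D2_bimod N M h) = BB.pt"
  and tensor_group_D2_bimod: "tensor_group R (D2_bimod N M h) (D2_bimod N M h) = BB.TG"
  by (simp_all add: pure_tensor_def tensor_group_def tensor_kernel_def relators_D2_bimod
      D2_bimod_simps fun_eq_iff)

lemma finsum_D2_bimod: "finsum (tensor R (D2_bimod N M h) (D2_bimod N M h)) = finsum BB.XY"
  by (simp add: fun_eq_iff finsum_def tensor_def tensor_group_D2_bimod bimod_of_def Let_def)

lemma comult_eq: "\<Delta> a = (\<Oplus>\<^bsub>BB.XY\<^esub>i\<in>I. BB.pt (\<gamma> i) (right_leg a (c i)))"
  by (simp add: D2_comult_def finsum_D2_bimod pure_D2_bimod right_leg_def contract_def)

lemma comult_closed [simp]: "a \<in> carrier A \<Longrightarrow> \<Delta> a \<in> carrier BB.XY"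
  unfolding comult_eq by (rule BB.XY.finsum_closed) (auto intro!: BB.pure_closed)

text \<open>The value is \<open>\<Sum>\<^sub>i \<gamma>\<^sub>i(m) c\<^sub>i\<^sup>1
  a(c\<^sub>i\<^sup>2 m')\<close>, which is the quasibasis expansion at \<open>m\<close> of the left
  linear map \<open>y \<mapsto> a(y m')\<close>.\<close>

lemma eval2_comult [simp]:
  assumes a: "a \<in> carrier A" and m: "m \<in> carrier M" "m' \<in> carrier M"
  shows "eval2 (\<Delta> a) (m, m') = a (m \<otimes> m')"
proof -
  interpret e: abelian_group_hom BB.XY M "\<lambda>q. eval2 q (m, m')"
    by (rule tensor_eval_hom[OF separated1 m])
  note l = left_linear_shift[OF left_linear_A[OF a] m(2)]
  have "eval2 (\<Delta> a) (m, m') = (\<Oplus>i\<in>I. eval2 (BB.pt (\<gamma> i) (right_leg a (c i))) (m, m'))"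
    unfolding comult_eq by (rule e.hom_finsum) (use a in \<open>auto intro!: BB.pure_closed\<close>)
  also have "\<dots> = (\<Oplus>i\<in>I. \<gamma> i m \<otimes> contract (\<lambda>y. a (y \<otimes> m')) (c i))"
    by (rule finsum_cong') (use a m l in \<open>auto simp: eval2_pure\<close>, simp add: right_leg_def)
  also have "\<dots> = a (m \<otimes> m')" by (rule quasibasis_expansion[OF l m(1)])
  finally show ?thesis .
qed

lemma comult_hom: "\<Delta> \<in> bimod_hom R R B BB.XY"
  unfolding bimod_hom_def
proof (intro CollectI conjI ballI funcsetI)
  show "\<Delta> (a \<oplus>\<^bsub>B\<^esub> b) = \<Delta> a \<oplus>\<^bsub>BB.XY\<^esub> \<Delta> b" if "a \<in> carrier B" "b \<in> carrier B" for a b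
    using that by (intro tensor2_eqI) auto
  show "\<Delta> (lact B r a) = lact BB.XY r (\<Delta> a)" if "r \<in> carrier R" "a \<in> carrier B" for r a
    using that by (intro tensor2_eqI) (auto simp: eval2_lact BB.XY.lact_closed)
  show "\<Delta> (ract B a r) = ract BB.XY (\<Delta> a) r" if "r \<in> carrier R" "a \<in> carrier B" for r a
    using that by (intro tensor2_eqI) (auto simp: eval2_ract BB.XY.ract_closed)
qed auto

lemma comult_add: "\<lbrakk>a \<in> carrier A; b \<in> carrier A\<rbrakk> \<Longrightarrow> \<Delta> (a \<oplus>\<^bsub>A\<^esub> b) = \<Delta> a \<oplus>\<^bsub>BB.XY\<^esub> \<Delta> b"
  and comult_lact: "\<lbrakk>r \<in> carrier R; a \<in> carrier A\<rbrakk> \<Longrightarrow> \<Delta> (D2_source M r \<otimes>\<^bsub>A\<^esub> a) = lact BB.XY r (\<Delta> a)"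
  and comult_ract: "\<lbrakk>r \<in> carrier R; a \<in> carrier A\<rbrakk> \<Longrightarrow> \<Delta> (D2_target M r \<otimes>\<^bsub>A\<^esub> a) = ract BB.XY (\<Delta> a) r"
  using comult_hom by (simp_all add: bimod_hom_def)

text \<open>Comultiplying a factor multiplies two arguments. On \<open>\<Delta> a\<close> this gives
  \<open>a(m (m' m''))\<close>, while \<open>assoc_comult_id\<close> gives
  \<open>a((m m') m'')\<close>: coassociativity is associativity in \<open>M\<close>.\<close>

lemma id_comult:
  defines "f \<equiv> tensor_lift BBr.XY (\<lambda>b c. BBr.pt b (\<Delta> c))"
  assumes q: "q \<in> carrier BB.XY"
  shows "f q \<in> carrier BBr.XY"
    and "\<lbrakk>m \<in> carrier M; m' \<in> carrier M; m'' \<in> carrier M\<rbrakk> \<Longrightarrow>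
      eval3 (f q) (m, m', m'') = eval2 q (m, m' \<otimes> m'')"
proof -
  have bal: "balanced_map R B B BBr.XY (\<lambda>b c. BBr.pt b (\<Delta> c))"
    by (rule balanced_mapI)
      (simp_all add: comult_add comult_lact pure_closed pure_add BBr.pure_balanced[simplified])
  interpret f: abelian_group_hom BB.XY BBr.XY f
    unfolding f_def by (rule BB.lift_hom[OF BBr.XY.abelian_group_axioms bal])
  show "f q \<in> carrier BBr.XY" using q by simp
  show "eval3 (f q) (m, m', m'') = eval2 q (m, m' \<otimes> m'')"
    if m: "m \<in> carrier M" "m' \<in> carrier M" "m'' \<in> carrier M"
    using q
  proof (induction q rule: BB.tensor_induct)
    case (pure a b)
    then show ?case
      using m by (simp add: f_def BB.lift_pure[OF BBr.XY.abelian_group_axioms bal] eval2_pure eval3_pure)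
  qed (use m in simp)
qed

lemma tensor_assoc_pure:
  assumes p: "p \<in> carrier BB.XY" and a: "a \<in> carrier A"
  shows "tensor_assoc R R B B B (BBl.pt p a) \<in> carrier BBr.XY"
    and "\<lbrakk>m \<in> carrier M; m' \<in> carrier M; m'' \<in> carrier M\<rbrakk> \<Longrightarrow>
      eval3 (tensor_assoc R R B B B (BBl.pt p a)) (m, m', m'') = eval2 p (m, m') \<otimes> a m''"
    and "abelian_group_hom BBl.XY BBr.XY (tensor_assoc R R B B B)"
proof -
  let ?g = "\<lambda>a p. tensor_lift BBr.XY (\<lambda>x y. BBr.pt x (BB.pt y a)) p"
  have bal: "balanced_map R B B BBr.XY (\<lambda>x y. BBr.pt x (BB.pt y a))" if "a \<in> carrier A" for a
    by (rule balanced_mapI)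
      (use that in \<open>simp_all add: pure_closed pure_add BBr.pure_balanced[simplified] BB.lact_pure[simplified]\<close>)
  have hom: "abelian_group_hom BB.XY BBr.XY (?g a)" if "a \<in> carrier A" for a
    by (rule BB.lift_hom[OF BBr.XY.abelian_group_axioms bal[OF that]])
  note cl = abelian_group_hom.hom_closed[OF hom]
  have ev: "eval3 (?g a p) (m, m', m'') = eval2 p (m, m') \<otimes> a m''"
    if a: "a \<in> carrier A" and p: "p \<in> carrier BB.XY"
      and m: "m \<in> carrier M" "m' \<in> carrier M" "m'' \<in> carrier M" for a p m m' m''
  proof -
    interpret g: abelian_group_hom BB.XY BBr.XY "?g a" by (rule hom[OF a])
    show ?thesis using p
    proof (induction p rule: BB.tensor_induct)
      case (pure x y)
      then show ?case
        using m a
        by (simp add: BB.lift_pure[OF BBr.XY.abelian_group_axioms bal] eval2_pure eval3_pure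
            BB.pure_closed m_assoc)
    qed (use m a in \<open>simp add: l_distr\<close>)
  qed
  \<comment> \<open>The outer lift is balanced because, for scalars \<open>r\<close>, both sides
    take the value \<open>p(m, m') r z(m'')\<close>, and values determine elements of A \<otimes> (A
    \<otimes> A).\<close>
  have bal2: "balanced_map R BB.XY B BBr.XY (\<lambda>q z. ?g z q)"
  proof (rule balanced_mapI)
    show "?g z q \<in> carrier BBr.XY" if "q \<in> carrier BB.XY" "z \<in> carrier B" for q z
      using that cl by simp
    show "?g z (q \<oplus>\<^bsub>BB.XY\<^esub> q') = ?g z q \<oplus>\<^bsub>BBr.XY\<^esub> ?g z q'"
      if "q \<in> carrier BB.XY" "q' \<in> carrier BB.XY" "z \<in> carrier B" for q q' z
      using that abelian_group_hom.hom_add[OF hom] by simp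
    show "?g (z \<oplus>\<^bsub>B\<^esub> z') q = ?g z q \<oplus>\<^bsub>BBr.XY\<^esub> ?g z' q"
      if "q \<in> carrier BB.XY" "z \<in> carrier B" "z' \<in> carrier B" for q z z'
      using that cl by (intro tensor3_eqI) (auto simp: ev r_distr)
    show "?g z (ract BB.XY q r) = ?g (lact B r z) q"
      if "q \<in> carrier BB.XY" "r \<in> carrier R" "z \<in> carrier B" for q r z
      using that cl by (intro tensor3_eqI) (auto simp: ev eval2_ract BB.XY.ract_closed m_assoc)
  qed
  have eq: "tensor_assoc R R B B B = tensor_lift BBr.XY (\<lambda>q z. ?g z q)"
    by (simp add: tensor_assoc_def Let_def)
  have "tensor_assoc R R B B B (BBl.pt p a) = ?g a p"
    unfolding eq by (rule BBl.lift_pure[OF BBr.XY.abelian_group_axioms bal2]) (use p a in auto)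
  then show "tensor_assoc R R B B B (BBl.pt p a) \<in> carrier BBr.XY"
    "\<lbrakk>m \<in> carrier M; m' \<in> carrier M; m'' \<in> carrier M\<rbrakk> \<Longrightarrow>
      eval3 (tensor_assoc R R B B B (BBl.pt p a)) (m, m', m'') = eval2 p (m, m') \<otimes> a m''"
    using cl[OF a p] ev[OF a p] by auto
  show "abelian_group_hom BBl.XY BBr.XY (tensor_assoc R R B B B)"
    unfolding eq by (rule BBl.lift_hom[OF BBr.XY.abelian_group_axioms bal2])
qed

lemma assoc_comult_id:
  defines "f \<equiv> tensor_lift BBl.XY (\<lambda>b c. BBl.pt (\<Delta> b) c)"
  assumes q: "q \<in> carrier BB.XY"
  shows "tensor_assoc R R B B B (f q) \<in> carrier BBr.XY"
    and "\<lbrakk>m \<in> carrier M; m' \<in> carrier M; m'' \<in> carrier M\<rbrakk> \<Longrightarrow>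
      eval3 (tensor_assoc R R B B B (f q)) (m, m', m'') = eval2 q (m \<otimes> m', m'')"
proof -
  have bal: "balanced_map R B B BBl.XY (\<lambda>b c. BBl.pt (\<Delta> b) c)"
    by (rule balanced_mapI)
      (simp_all add: comult_add comult_ract pure_closed pure_add pure_balanced)
  interpret f: abelian_group_hom BB.XY BBl.XY f
    unfolding f_def by (rule BB.lift_hom[OF BBl.XY.abelian_group_axioms bal])
  interpret g: abelian_group_hom BBl.XY BBr.XY "tensor_assoc R R B B B"
    by (rule tensor_assoc_pure(3)[OF q A.one_closed])
  show "tensor_assoc R R B B B (f q) \<in> carrier BBr.XY" using q by simp
  show "eval3 (tensor_assoc R R B B B (f q)) (m, m', m'') = eval2 q (m \<otimes> m', m'')"
    if m: "m \<in> carrier M" "m' \<in> carrier M" "m'' \<in> carrier M"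
    using q
  proof (induction q rule: BB.tensor_induct)
    case (pure a b)
    then show ?case
      using m by (simp add: f_def BB.lift_pure[OF BBl.XY.abelian_group_axioms bal] eval2_pure tensor_assoc_pure)
  qed (use m in simp)
qed

text \<open>Multiplying the factors of a tensor on the right by fixed maps only moves the points of
  evaluation from \<open>(m, m')\<close> to \<open>(n, n')\<close>. Both products with a
  comultiplication in the bialgebroid axioms have this form.\<close>

lemma eval2_lift:
  assumes bal: "balanced_map R B B BB.XY b" and q: "q \<in> carrier BB.XY"
    and m: "m \<in> carrier M" "m' \<in> carrier M" "n \<in> carrier M" "n' \<in> carrier M"
    and eq: "\<And>x y. \<lbrakk>x \<in> carrier A; y \<in> carrier A\<rbrakk> \<Longrightarrow> eval2 (b x y) (m, m') = x n \<otimes> y n'"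
  shows "eval2 (tensor_lift BB.XY b q) (m, m') = eval2 q (n, n')"
proof -
  interpret f: abelian_group_hom BB.XY BB.XY "tensor_lift BB.XY b"
    by (rule BB.lift_hom[OF BB.XY.abelian_group_axioms bal])
  show ?thesis using q
  proof (induction q rule: BB.tensor_induct)
    case (pure x y)
    then show ?case
      using m by (simp add: BB.lift_pure[OF BB.XY.abelian_group_axioms bal] eval2_pure eq)
  qed (use m in simp)
qed

text \<open>The actions of \<open>R\<close> on \<open>B\<close> multiply from the left, so right
  multiplication by \<open>e\<close> and \<open>d\<close> commutes with them.\<close>

lemma takeuchi_inner_balanced:
  "\<lbrakk>e \<in> carrier A; d \<in> carrier A\<rbrakk> \<Longrightarrow>
    balanced_map R B B BB.XY (\<lambda>a b. BB.pt (a \<otimes>\<^bsub>A\<^esub> e) (b \<otimes>\<^bsub>A\<^esub> d))"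
  by (intro balanced_mapI)
    (simp_all add: pure_closed pure_add A.l_distr A.m_assoc pure_balanced)

text \<open>Multiplying \<Delta>(a) by a tensor \<open>q\<close> yields the function
  \<open>a(q(m, m'))\<close>; for \<open>q = \<Delta> b\<close> this is \<open>a(b(m m'))\<close>,
  the value of \<Delta>(ab).\<close>

lemma comult_takeuchi_mult:
  assumes a: "a \<in> carrier A" and b: "b \<in> carrier A"
  shows "\<Delta> (a \<otimes>\<^bsub>A\<^esub> b) = takeuchi_mult R A (D2_source M) (D2_target M) (\<Delta> a) (\<Delta> b)"
proof -
  let ?f = "\<lambda>c d. tensor_lift BB.XY (\<lambda>a b. BB.pt (a \<otimes>\<^bsub>A\<^esub> c) (b \<otimes>\<^bsub>A\<^esub> d)) (\<Delta> a)"
  have cl: "?f c d \<in> carrier BB.XY" if "c \<in> carrier A" "d \<in> carrier A" for c d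
    using BB.lift_closed[OF BB.XY.abelian_group_axioms takeuchi_inner_balanced[OF that]] a by simp
  have ev: "eval2 (?f c d) (m, m') = a (c m \<otimes> d m')"
    if "c \<in> carrier A" "d \<in> carrier A" "m \<in> carrier M" "m' \<in> carrier M" for c d m m'
    using eval2_lift[OF takeuchi_inner_balanced[OF that(1,2)], of "\<Delta> a" m m' "c m" "d m'"] that a
    by (simp add: eval2_pure)
  \<comment> \<open>By \<open>ev\<close>, balance in \<open>(c, d)\<close> is
    \<open>a((c(m) r) d(m')) = a(c(m) (r d(m')))\<close>. This is the point at which the product
    depends on its left factor being a comultiplication.\<close>
  have bal: "balanced_map R B B BB.XY ?f"
    by (intro balanced_mapI tensor2_eqI)
      (auto simp: cl ev l_distr r_distr A_add[OF a] A_closed[OF a] m_assoc)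
  interpret f: abelian_group_hom BB.XY BB.XY "tensor_lift BB.XY ?f"
    by (rule BB.lift_hom[OF BB.XY.abelian_group_axioms bal])
  have "eval2 (tensor_lift BB.XY ?f q) (m, m') = a (eval2 q (m, m'))"
    if q: "q \<in> carrier BB.XY" and m: "m \<in> carrier M" "m' \<in> carrier M" for q m m'
    using q
  proof (induction q rule: BB.tensor_induct)
    case (pure x y)
    then show ?case
      using m by (simp add: BB.lift_pure[OF BB.XY.abelian_group_axioms bal] eval2_pure ev)
  qed (use m a in \<open>simp add: A_add\<close>)
  then have "\<Delta> (a \<otimes>\<^bsub>A\<^esub> b) = tensor_lift BB.XY ?f (\<Delta> b)"
    using a b by (intro tensor2_eqI) auto
  then show ?thesis by (simp add: takeuchi_mult_def)
qed

text \<open>The two sides have values \<open>a((m r) m')\<close> and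
  \<open>a(m (r m'))\<close>.\<close>

lemma comult_takeuchi:
  assumes a: "a \<in> carrier A" and r: "r \<in> carrier R"
  shows "tensor_lift BB.XY (\<lambda>b c. BB.pt (b \<otimes>\<^bsub>A\<^esub> D2_target M r) c) (\<Delta> a) =
    tensor_lift BB.XY (\<lambda>b c. BB.pt b (c \<otimes>\<^bsub>A\<^esub> D2_source M r)) (\<Delta> a)"
    (is "tensor_lift _ ?f _ = tensor_lift _ ?g _")
proof (rule tensor2_eqI)
  have f: "balanced_map R B B BB.XY ?f" and g: "balanced_map R B B BB.XY ?g"
    by (intro balanced_mapI; use r in \<open>simp add: pure_closed pure_add A.l_distr A.m_assoc pure_balanced\<close>)+
  show "tensor_lift BB.XY ?f (\<Delta> a) \<in> carrier BB.XY" "tensor_lift BB.XY ?g (\<Delta> a) \<in> carrier BB.XY"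
    using a f g by (auto intro!: BB.lift_closed BB.XY.abelian_group_axioms)
  show "eval2 (tensor_lift BB.XY ?f (\<Delta> a)) (m, m') = eval2 (tensor_lift BB.XY ?g (\<Delta> a)) (m, m')"
    if m: "m \<in> carrier M" "m' \<in> carrier M" for m m'
    using eval2_lift[OF f, of "\<Delta> a" m m' "m \<otimes> r" m'] eval2_lift[OF g, of "\<Delta> a" m m' m "r \<otimes> m'"] m a r
    by (simp add: eval2_pure m_assoc)
qed

text \<open>\<open>n a(1) = a(n) = a(1) n\<close> by linearity of \<open>a\<close> over
  \<open>N\<close> on both sides.\<close>

lemma counit_closed: "a \<in> carrier A \<Longrightarrow> D2_counit M a \<in> carrier R"
  using A_left[of a _ \<one>] A_right[of a _ \<one>] by (simp add: carrier_R D2_counit_def)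

text \<open>The counit evaluates a factor at 1, so the two laws read off \<Delta>(a) at
  \<open>(1, m)\<close> and \<open>(m, 1)\<close>. The auxiliary fact treats both at once, with
  \<open>e\<close> and \<open>e'\<close> factoring \<open>m\<close> as
  \<open>e m \<otimes> e' m\<close>.\<close>

lemma counit_laws:
  assumes a: "a \<in> carrier A"
  shows "tensor_lift A (\<lambda>b c. lact B (D2_counit M b) c) (\<Delta> a) = a"
    and "tensor_lift A (\<lambda>b c. ract B b (D2_counit M c)) (\<Delta> a) = a"
proof -
  have *: "tensor_lift A f (\<Delta> a) = a"
    if f: "balanced_map R B B A f"
      and e: "e \<in> carrier M \<rightarrow> carrier M" "e' \<in> carrier M \<rightarrow> carrier M"
        "\<And>m. m \<in> carrier M \<Longrightarrow> e m \<otimes> e' m = m"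
      and eq: "\<And>b c m. \<lbrakk>b \<in> carrier A; c \<in> carrier A; m \<in> carrier M\<rbrakk> \<Longrightarrow> f b c m = b (e m) \<otimes> c (e' m)"
    for f e e'
  proof -
    interpret f: abelian_group_hom BB.XY A "tensor_lift A f"
      by (rule BB.lift_hom[OF A.abelian_group_axioms f])
    have "tensor_lift A f q m = eval2 q (e m, e' m)" if q: "q \<in> carrier BB.XY" and m: "m \<in> carrier M" for q m
      using q
    proof (induction q rule: BB.tensor_induct)
      case (pure x y)
      then show ?case
        using m e by (simp add: BB.lift_pure[OF A.abelian_group_axioms f] eval2_pure eq Pi_def)
    qed (use m e in \<open>auto simp: Pi_def\<close>)
    then show ?thesis using a e by (intro A_ext) (auto simp: Pi_def)
  qed
  have 1: "balanced_map R B B A (\<lambda>b c. lact B (D2_counit M b) c)"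
    by (intro balanced_mapI; (intro A_ext)?)
      (auto simp: counit_closed, auto simp: D2_counit_def l_distr r_distr m_assoc)
  have 2: "balanced_map R B B A (\<lambda>b c. ract B b (D2_counit M c))"
    by (intro balanced_mapI; (intro A_ext)?)
      (auto simp: counit_closed, auto simp: D2_counit_def l_distr r_distr m_assoc)
  show "tensor_lift A (\<lambda>b c. lact B (D2_counit M b) c) (\<Delta> a) = a"
    by (rule *[OF 1, of "\<lambda>m. \<one>" "\<lambda>m. m"]) (auto simp: D2_counit_def)
  show "tensor_lift A (\<lambda>b c. ract B b (D2_counit M c)) (\<Delta> a) = a"
    by (rule *[OF 2, of "\<lambda>m. m" "\<lambda>m. \<one>"]) (auto simp: D2_counit_def)
qed

theorem left_bialgebroid_D2:
  "left_bialgebroid R A (D2_source M) (D2_target M) \<Delta> (D2_counit M)"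
proof (intro left_bialgebroid.intro left_bialgebroid_axioms.intro ring_R ring_A comult_hom
    counit_laws comult_takeuchi comult_takeuchi_mult)
  show "D2_source M \<in> ring_hom R A"
    by (rule ring_hom_memI) (auto intro!: A_ext simp: m_assoc l_distr)
  show "D2_target M \<in> ring_hom (opposite_ring R) A"
    by (rule ring_hom_memI) (auto intro!: A_ext simp: opposite_ring_def m_assoc r_distr)
  show "D2_source M r \<otimes>\<^bsub>A\<^esub> D2_target M r' = D2_target M r' \<otimes>\<^bsub>A\<^esub> D2_source M r"
    if "r \<in> carrier R" "r' \<in> carrier R" for r r'
    using that by (intro A_ext) (auto simp: m_assoc)
  show "D2_counit M \<in> bimod_hom R R B (regular_bimod R)"
    unfolding bimod_hom_def
    by (auto simp: counit_closed regular_bimod_def bimod_of_def) (auto simp: D2_counit_def)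
  show "tensor_assoc R R B B B (tensor_lift BBl.XY (\<lambda>b c. BBl.pt (\<Delta> b) c) (\<Delta> a)) =
      tensor_lift BBr.XY (\<lambda>b c. BBr.pt b (\<Delta> c)) (\<Delta> a)" if "a \<in> carrier A" for a
    using that by (intro tensor3_eqI) (auto simp: assoc_comult_id id_comult m_assoc)
  show "\<Delta> \<one>\<^bsub>A\<^esub> = BB.pt \<one>\<^bsub>A\<^esub> \<one>\<^bsub>A\<^esub>"
    by (intro tensor2_eqI) (auto simp: eval2_pure BB.pure_closed)
qed (auto simp: D2_counit_def)

section \<open>The module algebroid and its invariants\<close>

abbreviation "V \<equiv> module_bimod M (D2_source M) (D2_target M) (\<lambda>\<alpha> m. \<alpha> m)"

lemma V_simps [simp]:
  "carrier V = carrier M" "add V = add M" "zero V = zero M"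
  "lact V r m = D2_source M r m" "ract V m r = D2_target M r m"
  by (simp_all add: module_bimod_def bimod_of_def)

lemma bimodule_V: "bimodule R R V"
proof -
  interpret V: abelian_group V
    by (rule abelian_groupI) (auto simp: a_ac intro: bexI[of _ "\<ominus> x" for x] l_neg)
  show ?thesis by unfold_locales (auto simp: l_distr r_distr m_assoc)
qed

theorem left_module_algebroid_D2:
  "left_module_algebroid R A (D2_source M) (D2_target M) \<Delta> (D2_counit M) M (\<lambda>\<alpha> m. \<alpha> m)"
proof (intro left_module_algebroid.intro left_module_algebroid_axioms.intro left_bialgebroid_D2)
  show "left_module A M (\<lambda>\<alpha> m. \<alpha> m)"
    by (intro left_module.intro left_module_axioms.intro ring_A abelian_group_axioms)
      (simp_all add: A_add)
  show "ring M" ..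
  interpret VV: tensor_product R R R V V by (intro tensor_product.intro bimodule_V)
  let ?\<mu> = "tensor_lift M (\<otimes>)"
  have bal: "balanced_map R V V M (\<otimes>)"
    by (rule balanced_mapI) (auto simp: l_distr r_distr m_assoc)
  interpret \<mu>: abelian_group_hom VV.XY M ?\<mu> by (rule VV.lift_hom[OF abelian_group_axioms bal])
  have \<mu>_pure: "?\<mu> (VV.pt x y) = x \<otimes> y" if "x \<in> carrier M" "y \<in> carrier M" for x y
    using that VV.lift_pure[OF abelian_group_axioms bal] by simp
  show "\<exists>\<mu>\<in>bimod_hom R R VV.XY V. \<forall>x\<in>carrier M. \<forall>y\<in>carrier M. \<mu> (VV.pt x y) = x \<otimes> y"
  proof (intro bexI[of _ ?\<mu>] ballI \<mu>_pure)
    show "?\<mu> \<in> bimod_hom R R VV.XY V"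
      unfolding bimod_hom_def
    proof (intro CollectI conjI ballI funcsetI)
      show "?\<mu> (lact VV.XY r q) = lact V r (?\<mu> q)" if r: "r \<in> carrier R" and q: "q \<in> carrier VV.XY" for r q
        using q
      proof (induction q rule: VV.tensor_induct)
        case (pure x y)
        then show ?case using r VV.lact_pure[of r x y] by (simp add: \<mu>_pure m_assoc)
      next
        case (add q q')
        then show ?case using r by (simp add: VV.XY.lact_add VV.XY.lact_closed r_distr)
      qed
      show "?\<mu> (ract VV.XY q r) = ract V (?\<mu> q) r" if r: "r \<in> carrier R" and q: "q \<in> carrier VV.XY" for r q
        using q
      proof (induction q rule: VV.tensor_induct)
        case (pure x y)
        then show ?case using r VV.ract_pure[of r x y] by (simp add: \<mu>_pure m_assoc)
      next
        case (add q q')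
        then show ?case using r by (simp add: VV.XY.ract_add VV.XY.ract_closed l_distr)
      qed
    qed auto
  qed
  \<comment> \<open>The right-hand side is by definition the evaluation of \<Delta>(a) at
    \<open>(x, y)\<close>.\<close>
  show "a (x \<otimes> y) = tensor_lift M (\<lambda>b c. b x \<otimes> c y) (\<Delta> a)"
    if "a \<in> carrier A" "x \<in> carrier M" "y \<in> carrier M" for a x y
    using eval2_comult[OF that] by (simp add: tensor_eval_def)
qed (auto simp: D2_counit_def)

text \<open>With \<open>\<Delta> a = a\<^sub>1 \<otimes> a\<^sub>2\<close>, invariance gives
  \<open>a(m x) = a\<^sub>1(m) a\<^sub>2(x) = a\<^sub>1(m) a\<^sub>2(1) x = a(m) x\<close>. The
  middle equality is proved for arbitrary tensors, so that induction over pure tensors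
  applies.\<close>

lemma mult_invariant:
  assumes a: "a \<in> carrier A" and m: "m \<in> carrier M" and x: "x \<in> carrier M"
    and inv: "\<And>a. a \<in> carrier A \<Longrightarrow> a x = a \<one> \<otimes> x"
  shows "a (m \<otimes> x) = a m \<otimes> x"
proof -
  have "eval2 q (m, x) = eval2 q (m, \<one>) \<otimes> x" if "q \<in> carrier BB.XY" for q
    using that
  proof (induction q rule: BB.tensor_induct)
    case (pure b c)
    then show ?case using m x by (simp add: eval2_pure inv[of c] m_assoc)
  qed (use m x in \<open>simp add: l_distr\<close>)
  from this[OF comult_closed[OF a]] show ?thesis using a m x by simp
qed

end

section \<open>Left depth two and the endomorphisms of M as a right N-module\<close>

context ring_extension
begin

lemma bimod_power_NM [simp]:
  "carrier (bimod_power n NM) = {..<n} \<rightarrow>\<^sub>E carrier M"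
  "add (bimod_power n NM) v w = (\<lambda>i\<in>{..<n}. v i \<oplus> w i)"
  "zero (bimod_power n NM) = (\<lambda>i\<in>{..<n}. \<zero>)"
  "lact (bimod_power n NM) s v = (\<lambda>i\<in>{..<n}. h s \<otimes> v i)"
  "ract (bimod_power n NM) v m = (\<lambda>i\<in>{..<n}. v i \<otimes> m)"
  by (simp_all add: bimod_power_def)

lemma abelian_group_power: "abelian_group (bimod_power n NM)"
proof -
  have apply_closed: "v i \<in> carrier M" if "v \<in> {..<n} \<rightarrow>\<^sub>E carrier M" "i < n" for v i
    using that by auto
  let ?E = "bimod_power n NM"
  show ?thesis
  proof (rule abelian_groupI)
    show "\<exists>w\<in>carrier ?E. w \<oplus>\<^bsub>?E\<^esub> v = \<zero>\<^bsub>?E\<^esub>" if "v \<in> carrier ?E" for v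
      using that
      by (intro bexI[of _ "\<lambda>i\<in>{..<n}. \<ominus> v i"]) (simp_all add: fun_eq_iff apply_closed l_neg)
    show "\<zero>\<^bsub>?E\<^esub> \<oplus>\<^bsub>?E\<^esub> v = v" if "v \<in> carrier ?E" for v
      using that
      by (intro PiE_ext[of _ "{..<n}" "\<lambda>_. carrier M"]) (simp_all add: apply_closed)
  qed (simp_all add: fun_eq_iff apply_closed a_ac)
qed

text \<open>A direct summand of \<open>M^n\<close> has dual bases: projected unit vectors as
  generators, coordinates as coefficients. The map \<open>\<beta> j\<close> takes \<open>m\<close>
  to coordinate \<open>j\<close> of the image of \<open>m \<otimes> 1\<close>, and it lands in
  \<open>A\<close> because the embedding is left \<open>N\<close>-linear and right
  \<open>M\<close>-linear.\<close>

lemma left_D2_dual_bases: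
  assumes "left_D2 N M h"
  obtains n b \<beta> where "\<And>j. j < n \<Longrightarrow> b j \<in> carrier MM" "\<And>j. j < n \<Longrightarrow> \<beta> j \<in> carrier A"
    "\<And>m. m \<in> carrier M \<Longrightarrow> MM.pt m \<one> = (\<Oplus>\<^bsub>MM\<^esub>j\<in>{..<(n::nat)}. ract MM (b j) (\<beta> j m))"
proof -
  let ?D = "restrict_scalars h id MM"
  obtain n P Q F where
    "iso_to_direct_summand N M ?D (bimod_power n NM)"
    and P: "subbimodule N M (bimod_power n NM) P" and Q: "subbimodule N M (bimod_power n NM) Q"
    and PQ: "P \<inter> Q = {\<zero>\<^bsub>bimod_power n NM\<^esub>}" "P <+>\<^bsub>bimod_power n NM\<^esub> Q = carrier (bimod_power n NM)"
    and F: "F \<in> bimod_hom N M ?D ((bimod_power n NM)\<lparr>carrier := P\<rparr>)" and bij: "bij_betw F (carrier ?D) P"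
    using assms unfolding left_D2_def iso_to_direct_summand_def by blast
  define E where "E = bimod_power n NM"
  interpret E: abelian_group E unfolding E_def by (rule abelian_group_power)
  have E_simps: "carrier E = {..<n} \<rightarrow>\<^sub>E carrier M" "\<And>v w. v \<oplus>\<^bsub>E\<^esub> w = (\<lambda>i\<in>{..<n}. v i \<oplus> w i)"
    "\<And>s v. lact E s v = (\<lambda>i\<in>{..<n}. h s \<otimes> v i)" "\<And>v m. ract E v m = (\<lambda>i\<in>{..<n}. v i \<otimes> m)"
    by (simp_all add: E_def)
  have D_simps: "carrier ?D = carrier MM" "add ?D = add MM" "lact ?D s w = lact MM (h s) w"
    "ract ?D w m = ract MM w m" for s w m
    by (simp_all add: restrict_scalars_def bimod_of_def)
  have sgP: "subgroup P (add_monoid E)" and sgQ: "subgroup Q (add_monoid E)"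
    and rP: "\<And>v m. \<lbrakk>v \<in> P; m \<in> carrier M\<rbrakk> \<Longrightarrow> ract E v m \<in> P"
    and rQ: "\<And>v m. \<lbrakk>v \<in> Q; m \<in> carrier M\<rbrakk> \<Longrightarrow> ract E v m \<in> Q"
    using P Q by (auto simp: subbimodule_def E_def)
  have subP: "P \<subseteq> carrier E" and subQ: "Q \<subseteq> carrier E"
    using subgroup.subset[OF sgP] subgroup.subset[OF sgQ] by simp_all
  have F_closed: "F w \<in> P" and F_lact: "s \<in> carrier N \<Longrightarrow> F (lact MM (h s) w) = lact E s (F w)"
    and F_ract: "m \<in> carrier M \<Longrightarrow> F (ract MM w m) = ract E (F w) m"
    and F_add: "w' \<in> carrier MM \<Longrightarrow> F (w \<oplus>\<^bsub>MM\<^esub> w') = F w \<oplus>\<^bsub>E\<^esub> F w'"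
    if "w \<in> carrier MM" for w w' s m
    using F that unfolding bimod_hom_def E_def by (auto simp: D_simps simp del: bimod_power_NM)
  interpret F: abelian_group_hom MM E F
    by (intro abelian_group_homI_additive MM.XY.abelian_group_axioms E.abelian_group_axioms)
      (use F_closed F_add subP in auto)
  have F_apply: "F w j \<in> carrier M" if "w \<in> carrier MM" "j < n" for w j
    using F_closed[OF that(1)] subP that(2) by (auto simp: E_simps)
  \<comment> \<open>Split the unit vectors of \<open>M\<^sup>n = P \<oplus> Q\<close> as \<open>e\<^sub>j = p\<^sub>j + q\<^sub>j\<close>.  By uniqueness of the splitting every \<open>v \<in> P\<close>
    is \<open>\<Sum>\<^sub>j p\<^sub>j v\<^sub>j\<close>, and \<open>b\<^sub>j\<close> is the preimage of \<open>p\<^sub>j\<close>.\<close>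
  define e where "e j = (\<lambda>i\<in>{..<n}. if i = j then \<one> else \<zero>)" for j
  have "\<exists>p\<in>P. \<exists>q\<in>Q. e j = p \<oplus>\<^bsub>E\<^esub> q" for j
  proof -
    have "e j \<in> carrier E" by (auto simp: e_def E_simps)
    then have "e j \<in> P <+>\<^bsub>E\<^esub> Q" using PQ(2) by (simp add: E_def)
    then show ?thesis by (auto simp: set_add_def')
  qed
  then obtain p q where p: "\<And>j. p j \<in> P" and q: "\<And>j. q j \<in> Q" and e: "\<And>j. e j = p j \<oplus>\<^bsub>E\<^esub> q j"
    by metis
  have p_apply: "p j i \<in> carrier M" "q j i \<in> carrier M" if "i < n" for i j
    using p[of j] q[of j] subP subQ that by (auto simp: E_simps)
  have P_expansion: "v = (\<Oplus>\<^bsub>E\<^esub>j\<in>{..<n}. ract E (p j) (v j))" if v: "v \<in> P" for v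
  proof -
    have v': "v \<in> carrier E" and vj: "\<And>j. j < n \<Longrightarrow> v j \<in> carrier M"
      using v subP by (auto simp: E_simps)
    let ?p = "\<Oplus>\<^bsub>E\<^esub>j\<in>{..<n}. ract E (p j) (v j)" and ?q = "\<Oplus>\<^bsub>E\<^esub>j\<in>{..<n}. ract E (q j) (v j)"
    have pP: "?p \<in> P" by (rule E.finsum_subgroup[OF sgP]) (use rP p vj in auto)
    have qQ: "?q \<in> Q" by (rule E.finsum_subgroup[OF sgQ]) (use rQ q vj in auto)
    have clp: "ract E (p j) (v j) \<in> carrier E" "ract E (q j) (v j) \<in> carrier E" if "j < n" for j
      using rP[OF p] rQ[OF q] vj[OF that] subP subQ by blast+
    have "?p \<oplus>\<^bsub>E\<^esub> ?q = (\<Oplus>\<^bsub>E\<^esub>j\<in>{..<n}. ract E (p j) (v j) \<oplus>\<^bsub>E\<^esub> ract E (q j) (v j))"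
      by (rule E.finsum_addf[symmetric]) (use clp in auto)
    also have "\<dots> = (\<Oplus>\<^bsub>E\<^esub>j\<in>{..<n}. ract E (e j) (v j))"
      by (rule E.finsum_cong')
        (auto simp: e E_simps(2,4) p_apply vj l_distr intro!: ext, auto simp: E_simps(1) p_apply vj)
    also have "\<dots> = v"
    proof -
      have cl: "(\<lambda>j. ract E (e j) (v j)) \<in> {..<n} \<rightarrow> carrier E" by (auto simp: E_simps e_def vj)
      have "(\<Oplus>\<^bsub>E\<^esub>j\<in>{..<n}. ract E (e j) (v j)) i = v i" if i: "i < n" for i
      proof -
        interpret ev: abelian_group_hom E M "\<lambda>v. v i"
          by (intro abelian_group_homI_additive E.abelian_group_axioms abelian_group_axioms)
            (use i in \<open>auto simp: E_simps\<close>)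
        have "(\<Oplus>\<^bsub>E\<^esub>j\<in>{..<n}. ract E (e j) (v j)) i = (\<Oplus>j\<in>{..<n}. ract E (e j) (v j) i)"
          by (rule ev.hom_finsum[OF cl])
        also have "\<dots> = (\<Oplus>j\<in>{..<n}. if i = j then v j else \<zero>)"
          by (rule finsum_cong') (use i vj in \<open>auto simp: E_simps e_def\<close>)
        also have "\<dots> = v i" by (rule add.finprod_singleton) (use i vj in auto)
        finally show ?thesis .
      qed
      then show ?thesis
        using v' E.finsum_closed[OF cl] by (intro PiE_ext[of _ "{..<n}" "\<lambda>_. carrier M"]) (auto simp: E_simps(1))
    qed
    finally have sum: "?p \<oplus>\<^bsub>E\<^esub> ?q = v" .
    have cl: "?p \<in> carrier E" "?q \<in> carrier E" using pP qQ subP subQ by auto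
    have "y = x \<oplus>\<^bsub>E\<^esub> y \<ominus>\<^bsub>E\<^esub> x" if "x \<in> carrier E" "y \<in> carrier E" for x y
      using that unfolding a_minus_def
      by (subst E.a_comm[of x y]) (simp_all add: E.a_assoc E.r_neg)
    from this[OF cl] have "?q = v \<ominus>\<^bsub>E\<^esub> ?p" by (simp only: sum)
    also have "\<dots> \<in> P"
      using subgroup.m_closed[OF sgP v subgroup.m_inv_closed[OF sgP pP]] by (simp add: a_minus_def a_inv_def)
    finally have "?q \<in> P \<inter> Q" using qQ by simp
    then have "?q = \<zero>\<^bsub>E\<^esub>" using PQ(1) by (simp add: E_def del: bimod_power_NM)
    then show ?thesis using sum cl by simp
  qed
  define b where "b j = inv_into (carrier MM) F (p j)" for j
  have bij': "bij_betw F (carrier MM) P" using bij by (simp add: D_simps)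
  have b: "b j \<in> carrier MM" "F (b j) = p j" for j
    using bij' p[of j] unfolding b_def
    by (auto simp: bij_betw_def inv_into_into f_inv_into_f)
  define \<beta> where "\<beta> j = (\<lambda>m\<in>carrier M. F (MM.pt m \<one>) j)" for j
  have pt1: "MM.pt m \<one> \<in> carrier MM" if "m \<in> carrier M" for m
    using that MM.pure_closed by simp
  show thesis
  proof (rule that[of n b \<beta>])
    show "\<beta> j \<in> carrier A" if j: "j < n" for j
    proof (rule AI)
      show "\<beta> j (x \<oplus> y) = \<beta> j x \<oplus> \<beta> j y" if "x \<in> carrier M" "y \<in> carrier M" for x y
        using that j MM.pure_add_left[of x y \<one>] by (simp add: \<beta>_def F_add pt1 E_simps)
      show "\<beta> j (h s \<otimes> x) = h s \<otimes> \<beta> j x" if "s \<in> carrier N" "x \<in> carrier M" for s x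
        using that j MM.lact_pure[of "h s" x \<one>] F_lact[OF pt1[OF that(2)] that(1)]
        by (simp add: \<beta>_def E_simps)
      \<comment> \<open>Balance over \<open>N\<close> gives
        \<open>x h(s) \<otimes> 1 = x \<otimes> h(s) = (x \<otimes> 1) h(s)\<close>, so right
        \<open>N\<close>-linearity follows from right \<open>M\<close>-linearity of
        \<open>F\<close>.\<close>
      show "\<beta> j (x \<otimes> h s) = \<beta> j x \<otimes> h s" if "s \<in> carrier N" "x \<in> carrier M" for s x
        using that j MM.ract_pure[of "h s" x \<one>] MM.pure_balanced[of x s \<one>] F_ract[OF pt1[OF that(2)], of "h s"]
        by (simp add: \<beta>_def E_simps)
    qed (use j in \<open>auto simp: \<beta>_def F_apply pt1\<close>)
    show "MM.pt m \<one> = (\<Oplus>\<^bsub>MM\<^esub>j\<in>{..<n}. ract MM (b j) (\<beta> j m))" if m: "m \<in> carrier M" for m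
    proof -
      have cl: "(\<lambda>j. ract MM (b j) (\<beta> j m)) \<in> {..<n} \<rightarrow> carrier MM"
        using m b by (auto simp: \<beta>_def F_apply pt1 intro!: MM.XY.ract_closed)
      have "F (\<Oplus>\<^bsub>MM\<^esub>j\<in>{..<n}. ract MM (b j) (\<beta> j m)) = (\<Oplus>\<^bsub>E\<^esub>j\<in>{..<n}. F (ract MM (b j) (\<beta> j m)))"
        by (rule F.hom_finsum[OF cl])
      also have "\<dots> = (\<Oplus>\<^bsub>E\<^esub>j\<in>{..<n}. ract E (p j) (F (MM.pt m \<one>) j))"
        by (rule E.finsum_cong')
          (use m b in \<open>auto simp: F_ract \<beta>_def F_apply pt1\<close>, auto simp: E_simps p_apply F_apply pt1 m)
      also have "\<dots> = F (MM.pt m \<one>)" by (rule P_expansion[symmetric, OF F_closed[OF pt1[OF m]]])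
      finally show ?thesis
        using bij' pt1[OF m] MM.XY.finsum_closed[OF cl] by (auto simp: bij_betw_def inj_on_def)
    qed
  qed (rule b)
qed

text \<open>Since \<open>f\<close> is right \<open>N\<close>-linear,
  \<open>x \<otimes> y \<mapsto> f(x) y\<close> is a well-defined right \<open>M\<close>-linear map.
  It sends the expansion \<open>m \<otimes> 1 = \<Sum>\<^sub>j b\<^sub>j \<beta>\<^sub>j(m)\<close>
  to the expansion of \<open>f m\<close>, with the images of the \<open>b\<^sub>j\<close> as
  coefficients.\<close>

lemma right_End_expansion:
  assumes "left_D2 N M h" and f: "f \<in> carrier (right_module_End N M (\<lambda>m n. m \<otimes> h n))"
  obtains n x \<beta> where "\<And>j. j < n \<Longrightarrow> x j \<in> carrier M" "\<And>j. j < n \<Longrightarrow> \<beta> j \<in> carrier A"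
    "\<And>m. m \<in> carrier M \<Longrightarrow> f m = (\<Oplus>j\<in>{..<(n::nat)}. x j \<otimes> \<beta> j m)"
proof -
  obtain n b \<beta> where b: "\<And>j. j < n \<Longrightarrow> b j \<in> carrier MM" and \<beta>: "\<And>j. j < n \<Longrightarrow> \<beta> j \<in> carrier A"
    and e: "\<And>m. m \<in> carrier M \<Longrightarrow> MM.pt m \<one> = (\<Oplus>\<^bsub>MM\<^esub>j\<in>{..<(n::nat)}. ract MM (b j) (\<beta> j m))"
    by (rule left_D2_dual_bases[OF assms(1)]) blast
  have f': "f x \<in> carrier M" "y \<in> carrier M \<Longrightarrow> f (x \<oplus> y) = f x \<oplus> f y"
    "n \<in> carrier N \<Longrightarrow> f (x \<otimes> h n) = f x \<otimes> h n" if "x \<in> carrier M" for x y n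
    using f that by (auto simp: right_module_End_def map_ring_def)
  have bal: "balanced_map N MN NM M (\<lambda>x y. f x \<otimes> y)"
    by (rule balanced_mapI) (auto simp: f' l_distr r_distr m_assoc)
  let ?\<phi> = "tensor_lift M (\<lambda>x y. f x \<otimes> y)"
  interpret \<phi>: abelian_group_hom MM M ?\<phi> by (rule MM.lift_hom[OF abelian_group_axioms bal])
  have \<phi>_pure: "?\<phi> (MM.pt x y) = f x \<otimes> y" if "x \<in> carrier M" "y \<in> carrier M" for x y
    using MM.lift_pure[OF abelian_group_axioms bal] that by simp
  have ract: "?\<phi> (ract MM w m) = ?\<phi> w \<otimes> m" if w: "w \<in> carrier MM" and m: "m \<in> carrier M" for w m
    using w
  proof (induction w rule: MM.tensor_induct)
    case (pure x y)
    then show ?case using m by (simp add: MM.ract_pure \<phi>_pure f' m_assoc)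
  qed (use m in \<open>simp add: MM.XY.ract_add MM.XY.ract_closed l_distr\<close>)
  show thesis
  proof (rule that[of n "\<lambda>j. ?\<phi> (b j)" \<beta>])
    show "f m = (\<Oplus>j\<in>{..<n}. ?\<phi> (b j) \<otimes> \<beta> j m)" if m: "m \<in> carrier M" for m
    proof -
      have "f m = ?\<phi> (\<Oplus>\<^bsub>MM\<^esub>j\<in>{..<n}. ract MM (b j) (\<beta> j m))"
        using \<phi>_pure[of m \<one>] m by (simp add: f' flip: e)
      also have "\<dots> = (\<Oplus>j\<in>{..<n}. ?\<phi> (ract MM (b j) (\<beta> j m)))"
        by (rule \<phi>.hom_finsum) (use m b \<beta> in \<open>auto intro!: MM.XY.ract_closed\<close>)
      also have "\<dots> = (\<Oplus>j\<in>{..<n}. ?\<phi> (b j) \<otimes> \<beta> j m)"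
        by (rule finsum_cong') (use m b \<beta> in \<open>auto simp: ract\<close>)
      finally show ?thesis .
    qed
  qed (use b \<beta> in auto)
qed

end

context right_D2_extension
begin

theorem invariants_D2:
  assumes "left_D2 N M h" and bal: "balanced N M (\<lambda>m n. m \<otimes> h n)"
  shows "{n \<in> carrier M. \<forall>\<alpha>\<in>carrier A. \<alpha> n = D2_counit M \<alpha> \<otimes> n} = h ` carrier N"
proof (intro equalityI subsetI)
  fix x assume "x \<in> h ` carrier N"
  then obtain n where n: "n \<in> carrier N" "x = h n" by blast
  \<comment> \<open>Write \<open>h n\<close> as \<open>1 h(n)\<close> and use right
    \<open>N\<close>-linearity of \<alpha>.\<close>
  have "\<alpha> x = D2_counit M \<alpha> \<otimes> x" if "\<alpha> \<in> carrier A" for \<alpha>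
    using A_right[OF that n(1) one_closed] n by (simp add: D2_counit_def)
  then show "x \<in> {n \<in> carrier M. \<forall>\<alpha>\<in>carrier A. \<alpha> n = D2_counit M \<alpha> \<otimes> n}"
    using n by simp
next
  fix x assume "x \<in> {n \<in> carrier M. \<forall>\<alpha>\<in>carrier A. \<alpha> n = D2_counit M \<alpha> \<otimes> n}"
  then have x: "x \<in> carrier M" and inv: "\<And>a. a \<in> carrier A \<Longrightarrow> a x = a \<one> \<otimes> x"
    by (auto simp: D2_counit_def)
  let ?E = "right_module_End N M (\<lambda>m n. m \<otimes> h n)"
  have comm: "f (m \<otimes> x) = f m \<otimes> x" if f: "f \<in> carrier ?E" and m: "m \<in> carrier M" for f m
  proof -
    obtain n y \<beta> where y: "\<And>j. j < n \<Longrightarrow> y j \<in> carrier M" and \<beta>: "\<And>j. j < n \<Longrightarrow> \<beta> j \<in> carrier A"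
      and e: "\<And>m. m \<in> carrier M \<Longrightarrow> f m = (\<Oplus>j\<in>{..<(n::nat)}. y j \<otimes> \<beta> j m)"
      by (rule right_End_expansion[OF assms(1) f]) blast
    have "f (m \<otimes> x) = (\<Oplus>j\<in>{..<n}. y j \<otimes> \<beta> j (m \<otimes> x))" using e m x by simp
    also have "\<dots> = (\<Oplus>j\<in>{..<n}. y j \<otimes> \<beta> j m \<otimes> x)"
      by (rule finsum_cong') (use y \<beta> m x inv in \<open>auto simp: mult_invariant m_assoc\<close>)
    also have "\<dots> = f m \<otimes> x"
      using y \<beta> m x finsum_ldistr[of "{..<n}" x "\<lambda>j. y j \<otimes> \<beta> j m"] by (simp add: e Pi_def)
    finally show ?thesis .
  qed
  have "(\<lambda>v\<in>carrier M. v \<otimes> x) \<in> carrier (left_module_End ?E M (\<lambda>e v. e v))"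
    using x comm by (auto simp: left_module_End_def map_ring_def l_distr)
      (auto simp: right_module_End_def map_ring_def)
  then obtain n where n: "n \<in> carrier N" "(\<lambda>v\<in>carrier M. v \<otimes> x) = (\<lambda>v\<in>carrier M. v \<otimes> h n)"
    using bal unfolding balanced_def bij_betw_def by blast
  from fun_cong[OF n(2), of \<one>] have "x = h n" using x n(1) by simp
  then show "x \<in> h ` carrier N" using n(1) by blast
qed

end

theorem theorem4p1:
  fixes N :: "'n ring" and M :: "'m ring" and h :: "'n \<Rightarrow> 'm"
    and I :: "'i set" and c :: "'i \<Rightarrow> ('m \<times> 'm \<Rightarrow>\<^sub>0 int) set" and \<gamma> :: "'i \<Rightarrow> 'm \<Rightarrow> 'm"
  assumes "ring_hom_ring N M h"
    and "D2 N M h"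
    and "right_D2_quasibasis N M h I c \<gamma>"
  shows "left_bialgebroid (centralizer_ring N M h) (extension_End N M h)
           (D2_source M) (D2_target M) (D2_comult N M h I c \<gamma>) (D2_counit M) \<and>
         (\<forall>r\<in>carrier (centralizer_ring N M h). \<forall>r'\<in>carrier (centralizer_ring N M h).
            \<forall>\<alpha>\<in>carrier (extension_End N M h).
              D2_source M r \<otimes>\<^bsub>extension_End N M h\<^esub> D2_target M r' \<otimes>\<^bsub>extension_End N M h\<^esub> \<alpha> =
              lact (D2_bimod N M h) r (ract (D2_bimod N M h) \<alpha> r')) \<and>
         left_module_algebroid (centralizer_ring N M h) (extension_End N M h)
           (D2_source M) (D2_target M) (D2_comult N M h I c \<gamma>) (D2_counit M) M (\<lambda>\<alpha> m. \<alpha> m) \<and>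
         (balanced N M (\<lambda>m n. m \<otimes>\<^bsub>M\<^esub> h n) \<longrightarrow>
           {n \<in> carrier M. \<forall>\<alpha>\<in>carrier (extension_End N M h). \<alpha> n = D2_counit M \<alpha> \<otimes>\<^bsub>M\<^esub> n} =
           h ` carrier N)"
proof -
  interpret right_D2_extension N M h I c \<gamma>
    using assms(1,3)
    by (intro right_D2_extension.intro ring_extension.intro ring_extension_axioms.intro
        right_D2_extension_axioms.intro)
      (auto simp: ring_hom_ring_def ring_hom_ring_axioms_def ring_hom_ring.homh)
  \<comment> \<open>This identifies the bimodule structure induced by source and target with the
    pointwise one over which the comultiplication is formulated.\<close>
  have "D2_source M r \<otimes>\<^bsub>A\<^esub> D2_target M r' \<otimes>\<^bsub>A\<^esub> \<alpha> =
      lact (D2_bimod N M h) r (ract (D2_bimod N M h) \<alpha> r')"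
    if "r \<in> carrier R" "r' \<in> carrier R" "\<alpha> \<in> carrier A" for r r' \<alpha>
    using that by (simp add: lact_D2_bimod ract_D2_bimod A.m_assoc)
  moreover have "left_D2 N M h" using assms(2) by (simp add: D2_def)
  ultimately show ?thesis
    using left_bialgebroid_D2 left_module_algebroid_D2 invariants_D2 by blast
qed

end
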